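(* Let $\omega$ be any pure translation invariant finitely correlated state on the chain with one-site algebra $\mathcal{A}=M_d(\mathbb{C})$, memory algebra $\mathcal{B}=M_b(\mathbb{C})$ and generating data $(V,\rho)$ (as described in the context), with associated density matrices $\rho_{\mathcal{A}\otimes\mathcal{B}}$ on $\mathbb{C}^d\otimes\mathbb{C}^b$ and $\rho_{[1,n]}$ on $(\mathbb{C}^d)^{\otimes n}$. Then the spin at site $1$ is entangled with the spins at sites $[2,n]$ for $n$ large enough if and only if $\rho_{\mathcal{A}\otimes\mathcal{B}}$ is entangled. That is, the following are equivalent: (i) there is $n_0\ge2$ such that for all $n\ge n_0$ the density matrix $\rho_{[1,n]}$, regarded as a bipartite state on $\mathbb{C}^d\otimes(\mathbb{C}^d)^{\otimes n-1}$ (site $1$ versus sites $2,\dots,n$), is entangled; (ii) the density matrix $\rho_{\mathcal{A}\otimes\mathcal{B}}$, regarded as a bipartite state on $\mathbb{C}^d\otimes\mathbb{C}^b$, is entangled.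
   Context: Pure translation invariant finitely correlated states (FCS). Let $d,b\ge1$ be integers, $\mathcal{A}=M_d(\mathbb{C})$ (observables of one spin) and $\mathcal{B}=M_b(\mathbb{C})$ (the "memory"). Translation invariant states $\omega$ on the infinite chain $\mathcal{A}_{\mathbb{Z}}$ (the quasi-local limit of the algebras $\mathcal{A}^{\otimes(2n+1)}$ of sites $[-n,n]$) are determined by the density matrices $\rho_{[1,n]}$, $n\ge1$, of $n$ consecutive spins. A pure translation invariant FCS is given by the following data: - A linear map $V:\mathbb{C}^d\otimes\mathbb{C}^b\to\mathbb{C}^b$ with $VV^\dagger=\mathbf{1}_{\mathcal{B}}$. Set $\mathbb{E}(A\otimes B)=V(A\otimes B)V^\dagger$, a unital completely positive map $\mathcal{A}\otimes\mathcal{B}\to\mathcal{B}$, and $\hat{\mathbb{E}}(B)=\mathbb{E}(\mathbf{1}_{\mathcal{A}}\otimes B)$, a unital completely positive map $\mathcal{B}\to\mathcal{B}$. - A unique, non-singular $b\times b$ density matrix $\rho$ such that $\operatorname{Tr}(\rho\,\hat{\mathbb{E}}(B))=\operatorname{Tr}(\rho B)$ for all $B\in\mathcal{B}$. - The peripheral spectrum of $\hat{\mathbb{E}}$ is trivial: up to scalars, $\mathbf{1}_{\mathcal{B}}$ is the only eigenvector of $\hat{\mathbb{E}}$ with eigenvalue of modulus $1$ (a property of pure FCS). Consequently $\hat{\mathbb{E}}^n(B)\to\operatorname{Tr}(\rho B)\mathbf{1}_{\mathcal{B}}$ exponentially fast. The associated density matrices are $\rho_{\mathcal{A}\otimes\mathcal{B}}=V^\dagger\rho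 V$ on $\mathbb{C}^d\otimes\mathbb{C}^b$, and $$\rho_{[1,n]}=\operatorname{Tr}_{\mathcal{B}}(V_n^\dagger\,\rho_{\mathcal{A}\otimes\mathcal{B}}\,V_n),\qquad V_n=(\mathbf{1}_{\mathcal{A}}\otimes V)(\mathbf{1}_{\mathcal{A}^{\otimes2}}\otimes V)\cdots(\mathbf{1}_{\mathcal{A}^{\otimes n-1}}\otimes V),$$ where $V_n:(\mathbb{C}^d)^{\otimes n}\otimes\mathbb{C}^b\to\mathbb{C}^d\otimes\mathbb{C}^b$, $V_1$ is the identity, and $\operatorname{Tr}_{\mathcal{B}}$ is the partial trace over $\mathbb{C}^b$. A bipartite density matrix on $H_1\otimes H_2$ (finite-dimensional) is separable if it is a convex combination of product density matrices $\sigma_1\otimes\sigma_2$, and entangled otherwise; equivalently, it is entangled if and only if its entanglement of formation is strictly positive. The entanglement of formation of $\sigma_{12}$ is $\inf\sum_i p_i\,S(\operatorname{Tr}_{H_2}\sigma_{12}^i)$, with $S(\tau)=-\operatorname{Tr}\tau\log\tau$, over all convex decompositions $\sigma_{12}=\sum_ip_i\sigma_{12}^i$ into pure states. *)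

theory Defs
  imports "Jordan_Normal_Form.Schur_Decomposition"
begin

definition mat_trace :: "complex mat \<Rightarrow> complex" where
  "mat_trace A = (\<Sum>i<dim_row A. A $$ (i, i))"

(* Kronecker product. The basis vector e_i \<otimes> e_j of C^m \<otimes> C^n is the basis vector with
   index i * n + j of C^(m * n). With this convention the product is strictly associative, so
   (C^d)^{\<otimes> n} is C^(d ^ n) and coincides with C^d \<otimes> (C^d)^{\<otimes> (n - 1)}. *)
definition kron :: "complex mat \<Rightarrow> complex mat \<Rightarrow> complex mat" where
  "kron A B = mat (dim_row A * dim_row B) (dim_col A * dim_col B)
     (\<lambda>(i, j). A $$ (i div dim_row B, j div dim_col B) * B $$ (i mod dim_row B, j mod dim_col B))"

(* Partial trace over the second factor of C^m \<otimes> C^n. *)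
definition ptrace2 :: "nat \<Rightarrow> nat \<Rightarrow> complex mat \<Rightarrow> complex mat" where
  "ptrace2 m n M = mat m m (\<lambda>(i, j). \<Sum>k<n. M $$ (i * n + k, j * n + k))"

(* The order on complex numbers is that of HOL-Library.Complex_Order: 0 \<le> z means that z is real
   and nonnegative. Hence positivity includes hermiticity. *)
definition density_matrix :: "nat \<Rightarrow> complex mat \<Rightarrow> bool" where
  "density_matrix n A \<longleftrightarrow> A \<in> carrier_mat n n
     \<and> (\<forall>v \<in> carrier_vec n. 0 \<le> (A *\<^sub>v v) \<bullet>c v)
     \<and> mat_trace A = 1"

definition separable :: "nat \<Rightarrow> nat \<Rightarrow> complex mat \<Rightarrow> bool" where
  "separable m n A \<longleftrightarrow> (\<exists>(N::nat) (p :: nat \<Rightarrow> real) \<sigma> \<tau>.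
     (\<forall>k<N. 0 \<le> p k \<and> density_matrix m (\<sigma> k) \<and> density_matrix n (\<tau> k))
     \<and> (\<Sum>k<N. p k) = 1
     \<and> A = mat (m * n) (m * n)
             (\<lambda>(i, j). \<Sum>k<N. complex_of_real (p k) * kron (\<sigma> k) (\<tau> k) $$ (i, j)))"

definition entangled :: "nat \<Rightarrow> nat \<Rightarrow> complex mat \<Rightarrow> bool" where
  "entangled m n A \<longleftrightarrow> density_matrix (m * n) A \<and> \<not> separable m n A"

definition fcs_E :: "complex mat \<Rightarrow> complex mat \<Rightarrow> complex mat" where
  "fcs_E V X = V * X * mat_adjoint V"

definition fcs_Ehat :: "nat \<Rightarrow> complex mat \<Rightarrow> complex mat \<Rightarrow> complex mat" where
  "fcs_Ehat d V B = fcs_E V (kron (1\<^sub>m d) B)"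

definition fcs_invariant :: "nat \<Rightarrow> nat \<Rightarrow> complex mat \<Rightarrow> complex mat \<Rightarrow> bool" where
  "fcs_invariant d b V \<rho> \<longleftrightarrow>
     (\<forall>B \<in> carrier_mat b b. mat_trace (\<rho> * fcs_Ehat d V B) = mat_trace (\<rho> * B))"

locale pure_fcs =
  fixes d b :: nat and V \<rho> :: "complex mat"
  assumes d_pos: "1 \<le> d" and b_pos: "1 \<le> b"
    and V_carrier: "V \<in> carrier_mat b (d * b)"
    and V_coisometry: "V * mat_adjoint V = 1\<^sub>m b"
    and density: "density_matrix b \<rho>"
    and nonsingular: "invertible_mat \<rho>"
    and invariant: "fcs_invariant d b V \<rho>"
    and unique: "\<And>\<rho>'. density_matrix b \<rho>' \<Longrightarrow> fcs_invariant d b V \<rho>' \<Longrightarrow> \<rho>' = \<rho>"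
    and peripheral: "\<And>z B. B \<in> carrier_mat b b \<Longrightarrow> B \<noteq> 0\<^sub>m b b \<Longrightarrow> cmod z = 1 \<Longrightarrow>
          fcs_Ehat d V B = z \<cdot>\<^sub>m B \<Longrightarrow> \<exists>c. B = c \<cdot>\<^sub>m 1\<^sub>m b"

definition fcs_rho_AB :: "complex mat \<Rightarrow> complex mat \<Rightarrow> complex mat" where
  "fcs_rho_AB V \<rho> = mat_adjoint V * \<rho> * V"

(* V_n = (1_d \<otimes> V) (1_{d^2} \<otimes> V) ... (1_{d^(n-1)} \<otimes> V), and V_1 = 1. Only n \<ge> 1 is meaningful. *)
definition fcs_V :: "nat \<Rightarrow> nat \<Rightarrow> complex mat \<Rightarrow> nat \<Rightarrow> complex mat" where
  "fcs_V d b V n = foldr (\<lambda>k M. kron (1\<^sub>m (d ^ k)) V * M) [1..<n] (1\<^sub>m (d ^ n * b))"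

(* \<rho>_{[1,n]} as a matrix on C^(d ^ n). *)
definition fcs_rho_chain :: "nat \<Rightarrow> nat \<Rightarrow> complex mat \<Rightarrow> complex mat \<Rightarrow> nat \<Rightarrow> complex mat" where
  "fcs_rho_chain d b V \<rho> n =
     ptrace2 (d ^ n) b (mat_adjoint (fcs_V d b V n) * fcs_rho_AB V \<rho> * fcs_V d b V n)"

end

theory Submission
  imports Defs "Jordan_Normal_Form.Spectral_Radius"
begin

text \<open>Write \<open>P = 1 \<otimes> W\<close> with the coisometry \<open>W = V (1 \<otimes> V) \<dots>\<close> from \<open>n - 1\<close> spins and one memory to one
  memory, so that \<open>\<rho>\<^bsub>[1,n]\<^esub> = Tr\<^sub>B (P\<^sup>* \<rho>\<^sub>A\<^sub>B P)\<close> arises from \<open>\<rho>\<^sub>A\<^sub>B\<close> by a channel on the memory alone; hence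
  separability passes from \<open>\<rho>\<^sub>A\<^sub>B\<close> to the chain.

  Conversely, \<open>W (1 \<otimes> B) W\<^sup>*\<close> is the \<open>(n - 1)\<close>-st iterate of the transfer operator at \<open>B\<close> and converges
  to \<open>Tr(\<rho> B) 1\<close>. These are the Knill-Laflamme conditions in the limit, and the completely positive map
  \<open>Y \<mapsto> P (Y \<otimes> \<rho>\<^sup>-\<^sup>1) P\<^sup>*\<close>, which acts on the spins \<open>2, \<dots>, n\<close> alone, asymptotically inverts the channel.
  So if \<open>\<rho>\<^bsub>[1,n]\<^esub>\<close> is separable for infinitely many \<open>n\<close>, then \<open>\<rho>\<^sub>A\<^sub>B\<close> is a limit of normalised separable
  matrices, and the set of separable states is closed: by Caratheodory's theorem the number of product
  terms is bounded, and the terms range over a compact set.\<close>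

subsection \<open>Matrices and Kronecker products\<close>

text \<open>The chain states live on spaces that grow with \<open>n\<close>, so they have no common
  limit to pass to. Recovery carries all of them to the fixed space of one spin and one memory,
  where compactness is available and entrywise convergence suffices. The channel and its approximate
  inverse act on the second party alone, which is why separability survives both. The matrix
  adjoined in the recovery has a definite reason: adjoining R and expanding in matrix units of the
  memory gives in the limit \<open>Tr(\<rho> R \<rho>)\<close> times \<open>\<rho>AB\<close>, and
  the inverse of \<open>\<rho>\<close> turns this factor into \<open>Tr \<rho> = 1\<close>. Before
  the limit the recovered matrix is known to be positive, but its trace is not controlled; hence the
  detour through a cone of unnormalised separable matrices, with normalisation at the very end.
  Convergence of the iterates needs all eigenvalues off the identity strictly inside the unit disc.
  The peripheral condition treats modulus one only; larger moduli are excluded because conjugation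
  by a coisometry has bounds uniform in the number of spins.\<close>

lemma mult_mat_entry:
  assumes "A \<in> carrier_mat n m" "B \<in> carrier_mat m p" "i < n" "j < p"
  shows "(A * B) $$ (i, j) = (\<Sum>k<m. A $$ (i, k) * B $$ (k, j))"
  using assms by (simp add: scalar_prod_def lessThan_atLeast0)

lemma mat_adjoint_carrier [simp]: "A \<in> carrier_mat n m \<Longrightarrow> mat_adjoint A \<in> carrier_mat m n"
  unfolding mat_adjoint_def by auto

lemma mat_adjoint_entry:
  fixes A :: "complex mat"
  assumes "A \<in> carrier_mat n m" "i < m" "j < n"
  shows "mat_adjoint A $$ (i, j) = cnj (A $$ (j, i))"
  using assms unfolding mat_adjoint_def
  by (auto simp: mat_of_rows_def cols_def)

lemma mat_adjoint_mat_adjoint: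
  fixes A :: "complex mat"
  assumes "A \<in> carrier_mat n m"
  shows "mat_adjoint (mat_adjoint A) = A"
proof (rule eq_matI)
  have A': "mat_adjoint A \<in> carrier_mat m n" using assms by simp
  show "dim_row (mat_adjoint (mat_adjoint A)) = dim_row A"
    "dim_col (mat_adjoint (mat_adjoint A)) = dim_col A"
    using carrier_matD[OF mat_adjoint_carrier[OF A']] carrier_matD[OF assms] by simp_all
  fix i j assume "i < dim_row A" "j < dim_col A"
  then show "mat_adjoint (mat_adjoint A) $$ (i, j) = A $$ (i, j)"
    using assms A' by (simp add: mat_adjoint_entry[OF A'] mat_adjoint_entry[OF assms])
qed

lemma mat_adjoint_mult:
  fixes A B :: "complex mat"
  assumes "A \<in> carrier_mat n m" "B \<in> carrier_mat m p"
  shows "mat_adjoint (A * B) = mat_adjoint B * mat_adjoint A"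
proof (rule eq_matI)
  have AB: "A * B \<in> carrier_mat n p" using assms by simp
  have A': "mat_adjoint A \<in> carrier_mat m n" and B': "mat_adjoint B \<in> carrier_mat p m"
    using assms by simp_all
  have AB': "mat_adjoint (A * B) \<in> carrier_mat p n" using AB by simp
  show "dim_row (mat_adjoint (A * B)) = dim_row (mat_adjoint B * mat_adjoint A)"
    "dim_col (mat_adjoint (A * B)) = dim_col (mat_adjoint B * mat_adjoint A)"
    using AB' A' B' by auto
  fix i j assume "i < dim_row (mat_adjoint B * mat_adjoint A)"
    "j < dim_col (mat_adjoint B * mat_adjoint A)"
  then have ij: "i < p" "j < n" using A' B' by auto
  have "(mat_adjoint B * mat_adjoint A) $$ (i, j)
      = (\<Sum>k<m. mat_adjoint B $$ (i, k) * mat_adjoint A $$ (k, j))"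
    by (rule mult_mat_entry[OF B' A' ij])
  also have "\<dots> = (\<Sum>k<m. cnj (A $$ (j, k) * B $$ (k, i)))"
    using ij by (intro sum.cong refl)
      (simp add: mat_adjoint_entry[OF assms(1)] mat_adjoint_entry[OF assms(2)])
  also have "\<dots> = mat_adjoint (A * B) $$ (i, j)"
    using ij by (simp add: mat_adjoint_entry[OF AB] mult_mat_entry[OF assms ij(2,1)] del: index_mult_mat)
  finally show "mat_adjoint (A * B) $$ (i, j) = (mat_adjoint B * mat_adjoint A) $$ (i, j)" ..
qed

lemma mat_adjoint_one: "mat_adjoint (1\<^sub>m n) = (1\<^sub>m n :: complex mat)"
proof (rule eq_matI)
  fix i j assume "i < dim_row (1\<^sub>m n :: complex mat)" "j < dim_col (1\<^sub>m n :: complex mat)"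
  then show "mat_adjoint (1\<^sub>m n) $$ (i, j) = (1\<^sub>m n :: complex mat) $$ (i, j)"
    by (simp add: mat_adjoint_entry[OF one_carrier_mat])
qed (use carrier_matD[OF mat_adjoint_carrier[OF one_carrier_mat[of n]]] in auto)

lemma sum_swap3:
  "(\<Sum>i\<in>A. \<Sum>j\<in>B. \<Sum>k\<in>C. f i j k) = (\<Sum>k\<in>C. \<Sum>i\<in>A. \<Sum>j\<in>B. f i j k)"
proof -
  have "(\<Sum>i\<in>A. \<Sum>j\<in>B. \<Sum>k\<in>C. f i j k) = (\<Sum>i\<in>A. \<Sum>k\<in>C. \<Sum>j\<in>B. f i j k)"
    by (intro sum.cong refl sum.swap)
  also have "\<dots> = (\<Sum>k\<in>C. \<Sum>i\<in>A. \<Sum>j\<in>B. f i j k)" by (rule sum.swap)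
  finally show ?thesis .
qed

lemma sum_eq_single:
  fixes f :: "nat \<Rightarrow> 'a :: comm_monoid_add"
  assumes "k < n" "\<And>i. i < n \<Longrightarrow> i \<noteq> k \<Longrightarrow> f i = 0"
  shows "(\<Sum>i<n. f i) = f k"
proof -
  have "(\<Sum>i<n. f i) = (\<Sum>i\<in>{k}. f i)" using assms by (intro sum.mono_neutral_right) auto
  then show ?thesis by simp
qed

lemma pair_index_less: "i < m \<Longrightarrow> j < n \<Longrightarrow> i * n + j < m * (n::nat)"
proof -
  assume "i < m" "j < n"
  then have "i * n + j < Suc i * n" "Suc i * n \<le> m * n"
    by (simp, intro mult_right_mono) simp_all
  then show ?thesis by simp
qed

lemma sum_pair_index:
  fixes f :: "nat \<Rightarrow> 'a :: comm_monoid_add"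
  shows "(\<Sum>k<m * n. f k) = (\<Sum>i<m. \<Sum>j<n. f (i * n + j))"
proof -
  have "(\<Sum>k<m * n. f k) = (\<Sum>i<m. sum f {i * n..<i * n + n})"
    using sum.nat_group[of f n m] by simp
  also have "\<dots> = (\<Sum>i<m. \<Sum>j<n. f (i * n + j))"
  proof (rule sum.cong[OF refl])
    fix i
    show "sum f {i * n..<i * n + n} = (\<Sum>j<n. f (i * n + j))"
      using sum.shift_bounds_nat_ivl[of f 0 "i * n" n] by (simp add: add.commute lessThan_atLeast0)
  qed
  finally show ?thesis .
qed

lemma pair_index_cases:
  assumes "k < m * (n::nat)"
  obtains i j where "i < m" "j < n" "k = i * n + j"
proof
  have n: "n > 0" using assms by (cases n) auto
  show "k div n < m" using assms by (simp add: less_mult_imp_div_less)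
  show "k mod n < n" using n by simp
  show "k = k div n * n + k mod n" by simp
qed

lemma kron_carrier [simp]:
  "A \<in> carrier_mat m n \<Longrightarrow> B \<in> carrier_mat p q \<Longrightarrow> kron A B \<in> carrier_mat (m * p) (n * q)"
  unfolding kron_def by auto

lemma kron_entry:
  assumes "A \<in> carrier_mat m n" "B \<in> carrier_mat p q" "i < m" "k < p" "j < n" "l < q"
  shows "kron A B $$ (i * p + k, j * q + l) = A $$ (i, j) * B $$ (k, l)"
  using assms pair_index_less[of i m k p] pair_index_less[of j n l q] unfolding kron_def by auto

text \<open>On indices of the form \<open>i * p + k\<close> the div and mod in \<open>kron\<close>
  disappear; the Kronecker identities below are checked in this form.\<close>

lemma eq_mat_pairI:
  assumes "A \<in> carrier_mat (m * p) (n * q)" "B \<in> carrier_mat (m * p) (n * q)"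
    "\<And>i k j l. i < m \<Longrightarrow> k < p \<Longrightarrow> j < n \<Longrightarrow> l < q \<Longrightarrow>
       A $$ (i * p + k, j * q + l) = B $$ (i * p + k, j * q + l)"
  shows "A = B"
proof (rule eq_matI)
  fix x y assume "x < dim_row B" "y < dim_col B"
  then have "x < m * p" "y < n * q" using assms by auto
  then show "A $$ (x, y) = B $$ (x, y)"
    using assms(3) by (metis pair_index_cases)
qed (use assms in auto)

lemma kron_mult:
  assumes A: "A \<in> carrier_mat m n" and B: "B \<in> carrier_mat p q"
    and C: "C \<in> carrier_mat n r" and D: "D \<in> carrier_mat q s"
  shows "kron A B * kron C D = kron (A * C) (B * D)"
proof (rule eq_mat_pairI)
  have AB: "kron A B \<in> carrier_mat (m * p) (n * q)" and CD: "kron C D \<in> carrier_mat (n * q) (r * s)"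
    using assms by simp_all
  have AC: "A * C \<in> carrier_mat m r" and BD: "B * D \<in> carrier_mat p s" using assms by auto
  show "kron A B * kron C D \<in> carrier_mat (m * p) (r * s)" using AB CD by auto
  show "kron (A * C) (B * D) \<in> carrier_mat (m * p) (r * s)" using AC BD by simp
  fix i k j l assume ij: "i < m" "k < p" "j < r" "l < s"
  have "(kron A B * kron C D) $$ (i * p + k, j * s + l)
     = (\<Sum>x<n. \<Sum>y<q. kron A B $$ (i * p + k, x * q + y) * kron C D $$ (x * q + y, j * s + l))"
    by (simp only: mult_mat_entry[OF AB CD pair_index_less[OF ij(1,2)] pair_index_less[OF ij(3,4)]]
        sum_pair_index)
  also have "\<dots> = (\<Sum>x<n. \<Sum>y<q. (A $$ (i, x) * C $$ (x, j)) * (B $$ (k, y) * D $$ (y, l)))"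
    by (intro sum.cong refl) (simp add: kron_entry[OF A B] kron_entry[OF C D] ij)
  also have "\<dots> = (A * C) $$ (i, j) * (B * D) $$ (k, l)"
    by (simp only: mult_mat_entry[OF A C ij(1,3)] mult_mat_entry[OF B D ij(2,4)] sum_product)
  finally show "(kron A B * kron C D) $$ (i * p + k, j * s + l)
      = kron (A * C) (B * D) $$ (i * p + k, j * s + l)"
    by (simp only: kron_entry[OF AC BD ij])
qed

lemma mat_adjoint_kron:
  assumes A: "A \<in> carrier_mat m n" and B: "B \<in> carrier_mat p q"
  shows "mat_adjoint (kron A B) = kron (mat_adjoint A) (mat_adjoint B)"
proof (rule eq_mat_pairI)
  have AB: "kron A B \<in> carrier_mat (m * p) (n * q)" using assms by simp
  show "mat_adjoint (kron A B) \<in> carrier_mat (n * q) (m * p)" using AB by simp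
  have A': "mat_adjoint A \<in> carrier_mat n m" and B': "mat_adjoint B \<in> carrier_mat q p"
    using assms by auto
  show "kron (mat_adjoint A) (mat_adjoint B) \<in> carrier_mat (n * q) (m * p)" using A' B' by simp
  fix i k j l assume "i < n" "k < q" "j < m" "l < p"
  then show "mat_adjoint (kron A B) $$ (i * q + k, j * p + l)
      = kron (mat_adjoint A) (mat_adjoint B) $$ (i * q + k, j * p + l)"
    by (simp add: mat_adjoint_entry[OF AB] pair_index_less kron_entry[OF A B] kron_entry[OF A' B']
        mat_adjoint_entry[OF A] mat_adjoint_entry[OF B])
qed

lemma kron_one_one: "kron (1\<^sub>m m) (1\<^sub>m n) = 1\<^sub>m (m * n)"
proof (rule eq_mat_pairI)
  show "kron (1\<^sub>m m) (1\<^sub>m n) \<in> carrier_mat (m * n) (m * n)" by simp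
  fix i k j l assume *: "i < m" "k < n" "j < m" "l < n"
  have "i * n + k = j * n + l \<longleftrightarrow> i = j \<and> k = l"
  proof
    assume e: "i * n + k = j * n + l"
    then have "(i * n + k) div n = (j * n + l) div n" "(i * n + k) mod n = (j * n + l) mod n" by simp_all
    then show "i = j \<and> k = l" using * by simp
  qed simp
  then show "kron (1\<^sub>m m) (1\<^sub>m n) $$ (i * n + k, j * n + l) = 1\<^sub>m (m * n) $$ (i * n + k, j * n + l)"
    using * by (simp add: kron_entry[OF one_carrier_mat one_carrier_mat] pair_index_less)
qed simp

lemma kron_assoc:
  assumes A: "A \<in> carrier_mat m n" and B: "B \<in> carrier_mat p q" and C: "C \<in> carrier_mat r s"
  shows "kron (kron A B) C = kron A (kron B C)"
proof (rule eq_mat_pairI)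
  have AB: "kron A B \<in> carrier_mat (m * p) (n * q)" and BC: "kron B C \<in> carrier_mat (p * r) (q * s)"
    using assms by simp_all
  show "kron (kron A B) C \<in> carrier_mat (m * p * r) (n * q * s)" using AB C by simp
  show "kron A (kron B C) \<in> carrier_mat (m * p * r) (n * q * s)"
    using kron_carrier[OF A BC] by (simp only: mult.assoc)
  fix x k y l assume xy: "x < m * p" "k < r" "y < n * q" "l < s"
  from xy(1) obtain i i' where i: "i < m" "i' < p" "x = i * p + i'" by (rule pair_index_cases)
  from xy(3) obtain j j' where j: "j < n" "j' < q" "y = j * q + j'" by (rule pair_index_cases)
  have 1: "x * r + k = i * (p * r) + (i' * r + k)" "y * s + l = j * (q * s) + (j' * s + l)"
    unfolding i j by (simp_all add: algebra_simps)
  have "kron (kron A B) C $$ (x * r + k, y * s + l) = A $$ (i, j) * B $$ (i', j') * C $$ (k, l)"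
    unfolding kron_entry[OF AB C xy] unfolding i j by (simp add: kron_entry[OF A B] i j)
  also have "\<dots> = kron A (kron B C) $$ (x * r + k, y * s + l)"
    unfolding 1 by (simp add: kron_entry[OF A BC] kron_entry[OF B C] i j xy pair_index_less)
  finally show "kron (kron A B) C $$ (x * r + k, y * s + l) = kron A (kron B C) $$ (x * r + k, y * s + l)" .
qed

lemma mat_trace_mult_commute:
  assumes A: "A \<in> carrier_mat n m" and B: "B \<in> carrier_mat m n"
  shows "mat_trace (A * B) = mat_trace (B * A)"
proof -
  have "mat_trace (A * B) = (\<Sum>i<n. \<Sum>k<m. A $$ (i, k) * B $$ (k, i))"
    unfolding mat_trace_def using A by (intro sum.cong) (auto simp: mult_mat_entry[OF A B] simp del: index_mult_mat(1))
  also have "\<dots> = (\<Sum>k<m. \<Sum>i<n. B $$ (k, i) * A $$ (i, k))"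
    by (subst sum.swap) (simp add: mult.commute)
  also have "\<dots> = mat_trace (B * A)"
    unfolding mat_trace_def using B by (intro sum.cong) (auto simp: mult_mat_entry[OF B A] simp del: index_mult_mat(1))
  finally show ?thesis .
qed

lemma ptrace2_carrier [simp]: "ptrace2 m n M \<in> carrier_mat m m"
  unfolding ptrace2_def by simp

lemma mat_trace_ptrace2:
  assumes "M \<in> carrier_mat (m * n) (m * n)"
  shows "mat_trace (ptrace2 m n M) = mat_trace M"
  using assms by (simp add: mat_trace_def ptrace2_def sum_pair_index)

lemma mat_trace_kron:
  assumes A: "A \<in> carrier_mat m m" and B: "B \<in> carrier_mat n n"
  shows "mat_trace (kron A B) = mat_trace A * mat_trace B"
proof -
  have "mat_trace (kron A B) = (\<Sum>i<m. \<Sum>j<n. A $$ (i, i) * B $$ (j, j))"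
    using kron_carrier[OF A B] unfolding mat_trace_def
    by (auto simp: sum_pair_index kron_entry[OF A B] intro!: sum.cong)
  then show ?thesis using A B by (simp add: mat_trace_def sum_product)
qed

text \<open>The traced-out factor sits inside the second party, so the first factor passes through
  unchanged. This makes discarding the memory an operation local to the second party.\<close>

lemma ptrace2_kron:
  assumes A: "A \<in> carrier_mat m m" and B: "B \<in> carrier_mat (n * p) (n * p)"
  shows "ptrace2 (m * n) p (kron A B) = kron A (ptrace2 n p B)"
proof (rule eq_mat_pairI)
  show "ptrace2 (m * n) p (kron A B) \<in> carrier_mat (m * n) (m * n)" by simp
  show "kron A (ptrace2 n p B) \<in> carrier_mat (m * n) (m * n)" using A by simp
  fix i k j l assume *: "i < m" "k < n" "j < m" "l < n"
  have "ptrace2 (m * n) p (kron A B) $$ (i * n + k, j * n + l)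
     = (\<Sum>s<p. kron A B $$ ((i * n + k) * p + s, (j * n + l) * p + s))"
    using * by (simp add: ptrace2_def pair_index_less)
  also have "\<dots> = (\<Sum>s<p. A $$ (i, j) * B $$ (k * p + s, l * p + s))"
  proof (rule sum.cong[OF refl])
    fix s assume s: "s \<in> {..<p}"
    have e: "(i * n + k) * p + s = i * (n * p) + (k * p + s)" "(j * n + l) * p + s = j * (n * p) + (l * p + s)"
      by (simp_all add: algebra_simps)
    show "kron A B $$ ((i * n + k) * p + s, (j * n + l) * p + s) = A $$ (i, j) * B $$ (k * p + s, l * p + s)"
      unfolding e using * s by (simp add: kron_entry[OF A B] pair_index_less)
  qed
  also have "\<dots> = A $$ (i, j) * ptrace2 n p B $$ (k, l)"
    using * by (simp add: ptrace2_def sum_distrib_left)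
  also have "\<dots> = kron A (ptrace2 n p B) $$ (i * n + k, j * n + l)"
    using * by (simp add: kron_entry[OF A ptrace2_carrier])
  finally show "ptrace2 (m * n) p (kron A B) $$ (i * n + k, j * n + l)
      = kron A (ptrace2 n p B) $$ (i * n + k, j * n + l)" .
qed

subsection \<open>Positive semidefinite matrices\<close>

definition psd :: "nat \<Rightarrow> complex mat \<Rightarrow> bool" where
  "psd n A \<longleftrightarrow> A \<in> carrier_mat n n \<and> (\<forall>v \<in> carrier_vec n. 0 \<le> (A *\<^sub>v v) \<bullet>c v)"

text \<open>Coefficients and vectors are plain functions of indices, so that the induction on the
  dimension in the factorisation below can drop the last coordinate without rebuilding
  matrices.\<close>

definition qform :: "nat \<Rightarrow> (nat \<Rightarrow> nat \<Rightarrow> complex) \<Rightarrow> (nat \<Rightarrow> complex) \<Rightarrow> complex" where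
  "qform n a v = (\<Sum>i<n. \<Sum>j<n. a i j * v j * cnj (v i))"

lemma cscalar_prod_eq_qform:
  assumes A: "A \<in> carrier_mat n n" and v: "v \<in> carrier_vec n"
  shows "(A *\<^sub>v v) \<bullet>c v = qform n (\<lambda>i j. A $$ (i, j)) (\<lambda>i. v $ i)"
  using assms unfolding qform_def
  by (auto simp: scalar_prod_def lessThan_atLeast0 sum_distrib_right intro!: sum.cong)

lemma psd_iff_qform:
  "psd n A \<longleftrightarrow> A \<in> carrier_mat n n \<and> (\<forall>v. 0 \<le> qform n (\<lambda>i j. A $$ (i, j)) v)"
proof -
  have "0 \<le> qform n (\<lambda>i j. A $$ (i, j)) v"
    if A: "A \<in> carrier_mat n n" and p: "\<forall>v \<in> carrier_vec n. 0 \<le> (A *\<^sub>v v) \<bullet>c v" for v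
  proof -
    have "0 \<le> (A *\<^sub>v vec n v) \<bullet>c vec n v" using p by simp
    also have "\<dots> = qform n (\<lambda>i j. A $$ (i, j)) v"
      by (subst cscalar_prod_eq_qform[OF A]) (simp_all add: qform_def)
    finally show ?thesis .
  qed
  then show ?thesis unfolding psd_def by (auto simp: cscalar_prod_eq_qform)
qed

lemma density_matrix_iff: "density_matrix n A \<longleftrightarrow> psd n A \<and> mat_trace A = 1"
  by (auto simp: density_matrix_def psd_def)

lemma qform_two_point:
  assumes "p < n" "q < n" "p \<noteq> q"
  shows "qform n a (\<lambda>i. if i = p then s else if i = q then t else 0)
    = a p p * s * cnj s + a p q * t * cnj s + a q p * s * cnj t + a q q * t * cnj t"
proof -
  let ?v = "\<lambda>i. if i = p then s else if i = q then t else 0"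
  have red: "(\<Sum>i<n. f i) = f p + f q" if "\<And>i. i \<noteq> p \<Longrightarrow> i \<noteq> q \<Longrightarrow> f i = 0" for f :: "nat \<Rightarrow> complex"
  proof -
    have "(\<Sum>i<n. f i) = (\<Sum>i\<in>{p, q}. f i)"
      using assms that by (intro sum.mono_neutral_right) auto
    then show ?thesis using assms by simp
  qed
  have "qform n a ?v = (\<Sum>i<n. (a i p * s + a i q * t) * cnj (?v i))"
    unfolding qform_def using assms(3)
    by (intro sum.cong refl) (simp add: red algebra_simps)
  also have "\<dots> = (a p p * s + a p q * t) * cnj s + (a q p * s + a q q * t) * cnj t"
    using assms(3) by (simp add: red)
  finally show ?thesis by (simp add: algebra_simps)
qed

lemma qform_one_point:
  assumes "p < n"
  shows "qform n a (\<lambda>i. if i = p then s else 0) = a p p * s * cnj s"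
proof -
  have "qform n a (\<lambda>i. if i = p then s else 0)
      = (\<Sum>j<n. a p j * (if j = p then s else 0) * cnj s)"
    unfolding qform_def using assms by (subst sum_eq_single[of p]) auto
  also have "\<dots> = a p p * s * cnj s"
    using assms by (subst sum_eq_single[of p]) auto
  finally show ?thesis .
qed

lemma qform_nonneg_diag:
  assumes "\<And>v. 0 \<le> qform n a v" "p < n"
  shows "0 \<le> a p p"
  using assms(1)[of "\<lambda>i. if i = p then 1 else 0"] qform_one_point[OF assms(2), of a 1] by simp

text \<open>Polarisation: nonnegative values are real, and reality at \<open>e_p\<close>,
  \<open>e_q\<close>, \<open>e_p + e_q\<close> and \<open>e_p + \<i> e_q\<close> fixes both the real
  and the imaginary part.\<close>

lemma qform_nonneg_hermitian:
  assumes nn: "\<And>v. 0 \<le> qform n a v" and pq: "p < n" "q < n"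
  shows "a q p = cnj (a p q)"
proof (cases "p = q")
  case True
  then show ?thesis using qform_nonneg_diag[OF nn pq(1)] by (auto simp: less_eq_complex_def complex_eq_iff)
next
  case False
  have d: "Im (a p p) = 0" "Im (a q q) = 0"
    using qform_nonneg_diag[OF nn pq(1)] qform_nonneg_diag[OF nn pq(2)] by (auto simp: less_eq_complex_def)
  have "0 \<le> a p p + a p q + a q p + a q q"
    using nn[of "\<lambda>i. if i = p then 1 else if i = q then 1 else 0"]
    by (simp add: qform_two_point[OF pq False])
  moreover have "0 \<le> a p p + a p q * \<i> - a q p * \<i> + a q q"
    using nn[of "\<lambda>i. if i = p then 1 else if i = q then \<i> else 0"]
    by (simp add: qform_two_point[OF pq False] algebra_simps)
  ultimately show ?thesis using d by (auto simp: less_eq_complex_def complex_eq_iff)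
qed

text \<open>A weighted form of the bound of an off-diagonal entry by the two diagonal ones. The test
  vector is \<open>sqrt r\<close> at \<open>p\<close> and \<open>- u / sqrt r\<close> at
  \<open>q\<close>, with a phase \<open>u\<close> that rotates \<open>a p q\<close> onto its
  modulus. Weight 1 gives the bound by the trace; a free weight shows that a vanishing diagonal
  entry kills its column.\<close>

lemma qform_nonneg_entry_le:
  assumes nn: "\<And>v. 0 \<le> qform n a v" and pq: "p < n" "q < n" and "r > 0"
  shows "2 * cmod (a p q) \<le> r * Re (a p p) + Re (a q q) / r"
proof (cases "p = q")
  case True
  have "0 \<le> (r - 1)\<^sup>2" by simp
  then have "2 \<le> r + 1 / r" using \<open>r > 0\<close> by (simp add: field_simps power2_eq_square)
  moreover have "0 \<le> a p p" by (rule qform_nonneg_diag[OF nn pq(1)])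
  then have "cmod (a p p) = Re (a p p)" "0 \<le> Re (a p p)"
    by (auto simp: less_eq_complex_def cmod_eq_Re)
  ultimately have "2 * Re (a p p) \<le> (r + 1 / r) * Re (a p p)" by (intro mult_right_mono)
  then show ?thesis using True \<open>cmod (a p p) = _\<close> by (simp add: algebra_simps)
next
  case False
  define z where "z = a p q"
  define u where "u = (if z = 0 then 1 else cnj z / cmod z)"
  have zu: "z * u = cmod z"
    unfolding u_def using complex_norm_square[of z]
    by (auto simp: power2_eq_square nonzero_divide_eq_eq)
  have uu: "u * cnj u = 1"
    unfolding u_def using complex_norm_square[of z]
    by (auto simp: power2_eq_square mult.commute)
  have h: "a q p = cnj z" unfolding z_def by (rule qform_nonneg_hermitian[OF nn pq])
  have zu': "cnj z * cnj u = cmod z" using zu by (metis complex_cnj_complex_of_real complex_cnj_mult)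
  let ?s = "complex_of_real (sqrt r)"
  have s: "?s * ?s = r" using \<open>r > 0\<close> by (simp flip: of_real_mult)
  have s0: "?s \<noteq> 0" using \<open>r > 0\<close> by simp
  let ?t = "- u / ?s"
  have "0 \<le> a p p * ?s * cnj ?s + z * ?t * cnj ?s + cnj z * ?s * cnj ?t + a q q * ?t * cnj ?t"
    using nn[of "\<lambda>i. if i = p then ?s else if i = q then ?t else 0"]
    by (simp only: qform_two_point[OF pq False] h z_def[symmetric])
  also have "\<dots> = a p p * (?s * ?s) - z * u - cnj z * cnj u + a q q * (u * cnj u) / (?s * ?s)"
    using s0 by simp
  also have "\<dots> = a p p * r - 2 * cmod z + a q q / r"
    unfolding s zu zu' uu by simp
  finally have "0 \<le> Re (a p p * r - 2 * cmod z + a q q / r)" by (simp add: less_eq_complex_def)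
  then show ?thesis by (simp add: z_def mult.commute)
qed

lemma qform_nonneg_entry_zero:
  assumes nn: "\<And>v. 0 \<le> qform n a v" and pq: "p < n" "q < n" and z: "a q q = 0"
  shows "a p q = 0"
proof (rule ccontr)
  assume "a p q \<noteq> 0"
  define c where "c = cmod (a p q)"
  have c: "c > 0" using \<open>a p q \<noteq> 0\<close> by (simp add: c_def)
  define x where "x = Re (a p p)"
  have x: "x \<ge> 0" using qform_nonneg_diag[OF nn pq(1)] by (simp add: x_def less_eq_complex_def)
  \<comment> \<open>The weight \<open>c / (x + 1)\<close> is small enough that the surviving
    diagonal term is at most \<open>c\<close>, half of what the inequality demands.\<close>
  have "2 * c \<le> (c / (x + 1)) * x"
    using qform_nonneg_entry_le[OF nn pq, of "c / (x + 1)"] c x z by (simp add: c_def x_def)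
  also have "\<dots> \<le> c" using c x by (simp add: field_simps)
  finally show False using c by simp
qed

text \<open>Cholesky factorisation: when the last diagonal entry vanishes, so do its row and column, and
  the division by zero in the Schur complement is harmless.\<close>

lemma qform_nonneg_factorisation:
  assumes "\<And>v. 0 \<le> qform n a v"
  shows "\<exists>c. \<forall>i<n. \<forall>j<n. a i j = (\<Sum>k<n. c i k * cnj (c j k))"
  using assms
proof (induction n arbitrary: a)
  case 0
  then show ?case by simp
next
  case (Suc n)
  define \<alpha> where "\<alpha> = a n n"
  have herm: "a q p = cnj (a p q)" if "p < Suc n" "q < Suc n" for p q
    by (rule qform_nonneg_hermitian[OF Suc.prems that])
  have \<alpha>0: "0 \<le> \<alpha>" unfolding \<alpha>_def by (rule qform_nonneg_diag[OF Suc.prems]) simp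
  then have \<alpha>c: "cnj \<alpha> = \<alpha>" by (auto simp: less_eq_complex_def complex_eq_iff)
  have zero: "a p n = 0" "a n p = 0" if "\<alpha> = 0" "p < Suc n" for p
  proof -
    show "a p n = 0" using qform_nonneg_entry_zero[OF Suc.prems that(2), of n] that(1) by (simp add: \<alpha>_def)
    then show "a n p = 0" using herm[of p n] that(2) by simp
  qed
  have schur: "0 \<le> qform n (\<lambda>i j. a i j - a i n * a n j / \<alpha>) v" for v
  proof -
    define s where "s = (\<Sum>j<n. a n j * v j)"
    define t where "t = (\<Sum>i<n. a i n * cnj (v i))"
    \<comment> \<open>Completing the square: this last coordinate cancels the terms in
      \<open>cnj u\<close>, so the form of dimension \<open>Suc n\<close> at \<open>w\<close> equals
      the Schur complement form at \<open>v\<close>.\<close>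
    define u where "u = - s / \<alpha>"
    define w where "w i = (if i = n then u else v i)" for i
    have "qform (Suc n) a w = (\<Sum>i<n. (\<Sum>j<n. a i j * v j * cnj (v i)) + a i n * u * cnj (v i))
        + ((\<Sum>j<n. a n j * v j * cnj u) + \<alpha> * u * cnj u)"
      unfolding qform_def w_def \<alpha>_def by simp
    also have "\<dots> = qform n a v + u * t + (s * cnj u + \<alpha> * u * cnj u)"
      unfolding qform_def s_def t_def
      by (simp add: sum.distrib sum_distrib_left sum_distrib_right mult_ac)
    also have "s * cnj u + \<alpha> * u * cnj u = 0"
    proof (cases "\<alpha> = 0")
      case True
      then show ?thesis by (simp add: u_def)
    next
      case False
      then show ?thesis by (simp add: u_def)
    qed
    also have "qform n a v + u * t + 0 = qform n (\<lambda>i j. a i j - a i n * a n j / \<alpha>) v"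
    proof -
      have "u * t = - (\<Sum>i<n. \<Sum>j<n. (a i n * cnj (v i)) * (a n j * v j)) / \<alpha>"
        unfolding u_def s_def t_def sum_product[symmetric] by (simp add: mult_ac)
      also have "\<dots> = - (\<Sum>i<n. \<Sum>j<n. a i n * a n j / \<alpha> * v j * cnj (v i))"
        by (simp add: sum_divide_distrib mult_ac)
      finally show ?thesis unfolding qform_def by (simp add: algebra_simps sum_subtractf)
    qed
    finally show ?thesis using Suc.prems[of w] by simp
  qed
  from Suc.IH[OF schur] obtain c where
    c: "\<And>i j. i < n \<Longrightarrow> j < n \<Longrightarrow> a i j - a i n * a n j / \<alpha> = (\<Sum>k<n. c i k * cnj (c j k))" by blast
  define r where "r = complex_of_real (sqrt (Re \<alpha>))"
  have r: "r * r = \<alpha>" "cnj r = r" using \<alpha>0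
    by (auto simp: r_def less_eq_complex_def complex_eq_iff simp flip: of_real_mult)
  \<comment> \<open>The new column is the pivot column divided by the square root of the pivot; the
    older columns, which factor the Schur complement, get a zero in the new row.\<close>
  define c' where "c' i k = (if k = n then a i n / r else if i = n then 0 else c i k)" for i k
  have "a i j = (\<Sum>k<Suc n. c' i k * cnj (c' j k))" if ij: "i < Suc n" "j < Suc n" for i j
  proof -
    have last: "c' i n * cnj (c' j n) = a i n * a n j / \<alpha>"
      using herm[of j n] ij r by (simp add: c'_def)
    show ?thesis
    proof (cases "i < n \<and> j < n")
      case True
      then have "(\<Sum>k<n. c' i k * cnj (c' j k)) = a i j - a i n * a n j / \<alpha>"
        unfolding c[OF conjunct1[OF True] conjunct2[OF True]] by (intro sum.cong) (auto simp: c'_def)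
      then show ?thesis using last by simp
    next
      case False
      then have "i = n \<or> j = n" using ij by auto
      then have 1: "(\<Sum>k<n. c' i k * cnj (c' j k)) = 0"
        by (auto simp: c'_def intro!: sum.neutral)
      have "a i n * a n j / \<alpha> = a i j"
      proof (cases "\<alpha> = 0")
        case True
        then show ?thesis using zero[of i] zero[of j] ij \<open>i = n \<or> j = n\<close> by auto
      next
        case False
        then show ?thesis using \<open>i = n \<or> j = n\<close> by (auto simp: \<alpha>_def)
      qed
      then show ?thesis using 1 last by simp
    qed
  qed
  then show ?case by blast
qed

lemma psd_mult_adjoint:
  assumes C: "C \<in> carrier_mat n m"
  shows "psd n (C * mat_adjoint C)"
  unfolding psd_iff_qform
proof (intro conjI allI)
  have C': "mat_adjoint C \<in> carrier_mat m n" using C by simp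
  show "C * mat_adjoint C \<in> carrier_mat n n" using C C' by simp
  fix v :: "nat \<Rightarrow> complex"
  have "qform n (\<lambda>i j. (C * mat_adjoint C) $$ (i, j)) v
      = (\<Sum>i<n. \<Sum>j<n. \<Sum>k<m. (C $$ (i, k) * cnj (v i)) * cnj (C $$ (j, k) * cnj (v j)))"
    unfolding qform_def
    by (intro sum.cong refl)
      (simp add: mult_mat_entry[OF C C'] mat_adjoint_entry[OF C] sum_distrib_left sum_distrib_right mult_ac
        del: index_mult_mat)
  also have "\<dots> = (\<Sum>k<m. \<Sum>i<n. \<Sum>j<n. (C $$ (i, k) * cnj (v i)) * cnj (C $$ (j, k) * cnj (v j)))"
    by (rule sum_swap3)
  also have "\<dots> = (\<Sum>k<m. (\<Sum>i<n. C $$ (i, k) * cnj (v i)) * cnj (\<Sum>i<n. C $$ (i, k) * cnj (v i)))"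
    by (simp add: sum_product)
  also have "\<dots> = (\<Sum>k<m. of_real ((cmod (\<Sum>i<n. C $$ (i, k) * cnj (v i)))\<^sup>2))"
    by (simp only: complex_norm_square)
  also have "0 \<le> \<dots>" by (intro sum_nonneg) (simp add: less_eq_complex_def)
  finally show "0 \<le> qform n (\<lambda>i j. (C * mat_adjoint C) $$ (i, j)) v" .
qed

text \<open>With a factor at hand, closure under congruence and Kronecker products and hermiticity
  become identities between products, without any diagonalisation.\<close>

lemma psd_iff_factorisation:
  "psd n A \<longleftrightarrow> (\<exists>C \<in> carrier_mat n n. A = C * mat_adjoint C)"
proof
  assume "psd n A"
  then have A: "A \<in> carrier_mat n n" and nn: "\<And>v. 0 \<le> qform n (\<lambda>i j. A $$ (i, j)) v"
    by (auto simp: psd_iff_qform)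
  from qform_nonneg_factorisation[OF nn] obtain c where
    c: "\<And>i j. i < n \<Longrightarrow> j < n \<Longrightarrow> A $$ (i, j) = (\<Sum>k<n. c i k * cnj (c j k))" by blast
  define C where "C = mat n n (\<lambda>(i, k). c i k)"
  have C: "C \<in> carrier_mat n n" by (simp add: C_def)
  have "A = C * mat_adjoint C"
  proof (rule eq_matI)
    fix i j assume "i < dim_row (C * mat_adjoint C)" "j < dim_col (C * mat_adjoint C)"
    then have ij: "i < n" "j < n" using C mat_adjoint_carrier[OF C] by auto
    then show "A $$ (i, j) = (C * mat_adjoint C) $$ (i, j)"
      unfolding mult_mat_entry[OF C mat_adjoint_carrier[OF C] ij] c[OF ij]
      by (intro sum.cong refl) (simp add: mat_adjoint_entry[OF C], simp add: C_def)
  qed (use carrier_matD[OF A] carrier_matD[OF C] carrier_matD[OF mat_adjoint_carrier[OF C]] in simp_all)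
  with C show "\<exists>C \<in> carrier_mat n n. A = C * mat_adjoint C" by blast
qed (auto intro: psd_mult_adjoint)

lemma psd_carrier: "psd n A \<Longrightarrow> A \<in> carrier_mat n n"
  by (simp add: psd_def)

lemma psd_congruence:
  assumes "psd n A" and K: "K \<in> carrier_mat m n"
  shows "psd m (K * A * mat_adjoint K)"
proof -
  obtain C where C: "C \<in> carrier_mat n n" and A: "A = C * mat_adjoint C"
    using assms(1) psd_iff_factorisation by blast
  have C': "mat_adjoint C \<in> carrier_mat n n" and K': "mat_adjoint K \<in> carrier_mat n m"
    using C K by simp_all
  have KC: "K * C \<in> carrier_mat m n" using K C by simp
  have "K * A * mat_adjoint K = K * C * mat_adjoint (K * C)"
    unfolding A mat_adjoint_mult[OF K C] using K C C' K'
    by (simp only: assoc_mult_mat[OF K C C', symmetric] assoc_mult_mat[OF KC C' K'])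
  then show ?thesis using psd_mult_adjoint[OF KC] by simp
qed

lemma psd_kron:
  assumes "psd m A" "psd n B"
  shows "psd (m * n) (kron A B)"
proof -
  obtain C where C: "C \<in> carrier_mat m m" and A: "A = C * mat_adjoint C"
    using assms(1) psd_iff_factorisation by blast
  obtain D where D: "D \<in> carrier_mat n n" and B: "B = D * mat_adjoint D"
    using assms(2) psd_iff_factorisation by blast
  have "kron A B = kron C D * mat_adjoint (kron C D)"
    unfolding A B mat_adjoint_kron[OF C D]
    by (rule kron_mult[symmetric, OF C D mat_adjoint_carrier[OF C] mat_adjoint_carrier[OF D]])
  then show ?thesis using psd_mult_adjoint[OF kron_carrier[OF C D]] by simp
qed

lemma psd_mat_adjoint:
  assumes "psd n A"
  shows "mat_adjoint A = A"
proof -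
  obtain C where C: "C \<in> carrier_mat n n" and A: "A = C * mat_adjoint C"
    using assms psd_iff_factorisation by blast
  show ?thesis unfolding A mat_adjoint_mult[OF C mat_adjoint_carrier[OF C]] mat_adjoint_mat_adjoint[OF C] ..
qed

text \<open>The form of the partial trace at \<open>v\<close> is the sum over \<open>k\<close> of
  the form of \<open>M\<close> at the product of \<open>v\<close> with the basis vector
  \<open>e_k\<close>; the function of \<open>x mod n\<close> and \<open>x div n\<close> below is
  that product vector.\<close>

lemma psd_ptrace2:
  assumes "psd (m * n) M"
  shows "psd m (ptrace2 m n M)"
  unfolding psd_iff_qform
proof (intro conjI allI)
  fix v :: "nat \<Rightarrow> complex"
  have "qform m (\<lambda>i j. ptrace2 m n M $$ (i, j)) v
      = (\<Sum>i<m. \<Sum>j<m. \<Sum>k<n. M $$ (i * n + k, j * n + k) * v j * cnj (v i))"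
    by (simp add: qform_def ptrace2_def sum_distrib_right)
  also have "\<dots> = (\<Sum>k<n. \<Sum>i<m. \<Sum>j<m. M $$ (i * n + k, j * n + k) * v j * cnj (v i))"
    by (rule sum_swap3)
  also have "\<dots> = (\<Sum>k<n. qform (m * n) (\<lambda>i j. M $$ (i, j)) (\<lambda>x. if x mod n = k then v (x div n) else 0))"
  proof (rule sum.cong[OF refl])
    fix k assume k: "k \<in> {..<n}"
    let ?v = "\<lambda>x. if x mod n = k then v (x div n) else 0"
    have "qform (m * n) (\<lambda>i j. M $$ (i, j)) ?v
        = (\<Sum>i<m. \<Sum>l<n. \<Sum>j<m. \<Sum>l'<n. M $$ (i * n + l, j * n + l') * ?v (j * n + l') * cnj (?v (i * n + l)))"
      by (simp only: qform_def sum_pair_index)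
    also have "\<dots> = (\<Sum>i<m. \<Sum>j<m. \<Sum>l'<n. M $$ (i * n + k, j * n + l') * ?v (j * n + l') * cnj (?v (i * n + k)))"
      using k by (intro sum.cong refl sum_eq_single) auto
    also have "\<dots> = (\<Sum>i<m. \<Sum>j<m. M $$ (i * n + k, j * n + k) * ?v (j * n + k) * cnj (?v (i * n + k)))"
      using k by (intro sum.cong refl sum_eq_single) auto
    finally show "(\<Sum>i<m. \<Sum>j<m. M $$ (i * n + k, j * n + k) * v j * cnj (v i))
      = qform (m * n) (\<lambda>i j. M $$ (i, j)) ?v" using k by simp
  qed
  also have "0 \<le> \<dots>" using assms by (intro sum_nonneg) (simp add: psd_iff_qform)
  finally show "0 \<le> qform m (\<lambda>i j. ptrace2 m n M $$ (i, j)) v" .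
qed simp

text \<open>The entry bound with weight 1, together with nonnegativity of the diagonal. It is the
  source of boundedness in the compactness argument.\<close>

lemma psd_entry_le_trace:
  assumes "psd n A" "i < n" "j < n"
  shows "cmod (A $$ (i, j)) \<le> Re (mat_trace A)"
proof -
  have nn: "\<And>v. 0 \<le> qform n (\<lambda>i j. A $$ (i, j)) v" and A: "A \<in> carrier_mat n n"
    using assms(1) by (auto simp: psd_iff_qform)
  have d: "0 \<le> Re (A $$ (k, k))" if "k < n" for k
    using qform_nonneg_diag[OF nn that] by (simp add: less_eq_complex_def)
  have tr: "Re (A $$ (k, k)) \<le> Re (mat_trace A)" if "k < n" for k
    using A that d unfolding mat_trace_def Re_sum by (intro member_le_sum) auto
  show ?thesis
    using qform_nonneg_entry_le[OF nn assms(2,3), of 1] tr[OF assms(2)] tr[OF assms(3)] by simp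
qed

lemma psd_trace_nonneg:
  assumes "psd n A"
  shows "0 \<le> mat_trace A"
  using assms qform_nonneg_diag[of n "\<lambda>i j. A $$ (i, j)"]
  unfolding mat_trace_def psd_iff_qform by (auto intro!: sum_nonneg)

lemma psd_trace_zero:
  assumes "psd n A" "mat_trace A = 0"
  shows "A = 0\<^sub>m n n"
proof (rule eq_matI)
  fix i j assume "i < dim_row (0\<^sub>m n n :: complex mat)" "j < dim_col (0\<^sub>m n n :: complex mat)"
  then show "A $$ (i, j) = 0\<^sub>m n n $$ (i, j)"
    using psd_entry_le_trace[OF assms(1), of i j] assms(2) by simp
qed (use psd_carrier[OF assms(1)] in auto)

lemma psd_smult:
  assumes "psd n A" "0 \<le> c"
  shows "psd n (c \<cdot>\<^sub>m A)"
proof -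
  have "qform n (\<lambda>i j. (c \<cdot>\<^sub>m A) $$ (i, j)) v = c * qform n (\<lambda>i j. A $$ (i, j)) v" for v
    using psd_carrier[OF assms(1)] unfolding qform_def by (auto simp: sum_distrib_left mult_ac intro!: sum.cong)
  then show ?thesis using assms by (auto simp: psd_iff_qform)
qed

lemma psd_zero: "psd n (0\<^sub>m n n)"
  by (simp add: psd_iff_qform qform_def)

lemma psd_closed:
  assumes "\<And>t. psd n (A t)" "L \<in> carrier_mat n n"
    and "\<And>i j. i < n \<Longrightarrow> j < n \<Longrightarrow> (\<lambda>t. A t $$ (i, j)) \<longlonglongrightarrow> L $$ (i, j)"
  shows "psd n L"
  unfolding psd_iff_qform
proof (intro conjI allI)
  fix v
  have lim: "(\<lambda>t. qform n (\<lambda>i j. A t $$ (i, j)) v) \<longlonglongrightarrow> qform n (\<lambda>i j. L $$ (i, j)) v"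
    unfolding qform_def by (intro tendsto_intros assms(3)) auto
  have nn: "0 \<le> qform n (\<lambda>i j. A t $$ (i, j)) v" for t
    using assms(1) by (simp add: psd_iff_qform)
  have "0 \<le> Re (qform n (\<lambda>i j. L $$ (i, j)) v)"
    by (rule LIMSEQ_le_const[OF tendsto_Re[OF lim]]) (use nn in \<open>auto simp: less_eq_complex_def\<close>)
  moreover have "(\<lambda>t. 0) \<longlonglongrightarrow> Im (qform n (\<lambda>i j. L $$ (i, j)) v)"
    using tendsto_Im[OF lim] nn by (simp add: less_eq_complex_def)
  then have "Im (qform n (\<lambda>i j. L $$ (i, j)) v) = 0" by (simp add: LIMSEQ_const_iff)
  ultimately show "0 \<le> qform n (\<lambda>i j. L $$ (i, j)) v" by (simp add: less_eq_complex_def)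
qed (rule assms)

subsection \<open>Caratheodory's theorem for cones\<close>

text \<open>More vectors than coordinates are linearly dependent; the dependence is read off from
  the kernel of a singular square matrix.\<close>

lemma exists_linear_relation:
  fixes v :: "'a \<Rightarrow> 'b \<Rightarrow> real"
  assumes S: "finite S" and J: "finite J" and card: "card J < card S"
  shows "\<exists>c. (\<exists>k\<in>S. c k \<noteq> 0) \<and> (\<forall>j\<in>J. (\<Sum>k\<in>S. c k * v k j) = 0)"
proof -
  define N where "N = card S"
  obtain f where f: "bij_betw f {0..<N} S" using ex_bij_betw_nat_finite[OF S] N_def by blast
  obtain g where g: "bij_betw g {0..<card J} J" using ex_bij_betw_nat_finite[OF J] by blast
  \<comment> \<open>The rows below \<open>card J\<close> hold the coordinates. Since
    \<open>card J < N\<close>, there is room for one zero row, which makes the determinant vanish;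
    the content of any later rows is immaterial.\<close>
  define M where "M = mat\<^sub>r N N (\<lambda>r. if r = card J then 0\<^sub>v N else vec N (\<lambda>k. v (f k) (g r)))"
  have M: "M \<in> carrier_mat N N" unfolding M_def by (rule mat_row_carrierI)
  have "det M = 0" unfolding M_def by (rule det_row_0) (use card N_def in auto)
  then obtain x where x: "x \<in> carrier_vec N" "x \<noteq> 0\<^sub>v N" "M *\<^sub>v x = 0\<^sub>v N"
    using det_0_iff_vec_prod_zero_field[OF M] by blast
  define c where "c k = x $ (the_inv_into {0..<N} f k)" for k
  have cf: "c (f i) = x $ i" if "i < N" for i
    using that f by (simp add: c_def bij_betw_def the_inv_into_f_f)
  have "\<exists>k\<in>S. c k \<noteq> 0"
  proof (rule ccontr)
    assume "\<not> (\<exists>k\<in>S. c k \<noteq> 0)"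
    then have "x $ i = 0" if "i < N" for i using cf[OF that] f that by (auto simp: bij_betw_def)
    then show False using x(1,2) by (metis eq_vecI carrier_vecD index_zero_vec)
  qed
  moreover have "(\<Sum>k\<in>S. c k * v k j) = 0" if "j \<in> J" for j
  proof -
    have "j \<in> g ` {0..<card J}" using g that by (simp add: bij_betw_def)
    then obtain r where r: "r < card J" "j = g r" by auto
    have "(\<Sum>k\<in>S. c k * v k j) = (\<Sum>i\<in>{0..<N}. c (f i) * v (f i) j)"
      by (rule sum.reindex_bij_betw[OF f, symmetric])
    also have "\<dots> = (\<Sum>i\<in>{0..<N}. v (f i) (g r) * x $ i)"
      using cf r by (intro sum.cong) auto
    also have "\<dots> = (M *\<^sub>v x) $ r"
      using r card x(1) by (simp add: M_def scalar_prod_def N_def)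
    also have "\<dots> = 0" using x(3) r card N_def by simp
    finally show ?thesis .
  qed
  ultimately show ?thesis by blast
qed

text \<open>While more than \<open>card J\<close> coefficients are nonzero, their vectors satisfy a
  linear relation. Subtracting a suitable multiple of it changes no coordinate sum, keeps the
  coefficients nonnegative and removes at least one of them; induction is on the number of nonzero
  coefficients.\<close>

lemma conic_caratheodory:
  fixes v :: "'a \<Rightarrow> 'b \<Rightarrow> real"
  assumes I: "finite I" and J: "finite J" and p: "\<And>k. k \<in> I \<Longrightarrow> 0 \<le> p k"
  shows "\<exists>q. (\<forall>k\<in>I. 0 \<le> q k) \<and> (\<forall>j\<in>J. (\<Sum>k\<in>I. q k * v k j) = (\<Sum>k\<in>I. p k * v k j))
      \<and> card {k \<in> I. q k \<noteq> 0} \<le> card J"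
  using p
proof (induction "card {k \<in> I. p k \<noteq> 0}" arbitrary: p rule: less_induct)
  case less
  define S where "S = {k \<in> I. p k \<noteq> 0}"
  have S: "finite S" "S \<subseteq> I" using I by (auto simp: S_def)
  show ?case
  proof (cases "card S \<le> card J")
    case True
    then show ?thesis using less.prems S_def by blast
  next
    case False
    then obtain c0 where c0: "\<exists>k\<in>S. c0 k \<noteq> 0" "\<forall>j\<in>J. (\<Sum>k\<in>S. c0 k * v k j) = 0"
      using exists_linear_relation[OF S(1) J, of v] by auto
    \<comment> \<open>The sign is chosen so that some coefficient is positive and the minimum below
      ranges over a nonempty set.\<close>
    define c where "c = (if \<exists>k\<in>S. c0 k > 0 then c0 else (\<lambda>k. - c0 k))"
    have c: "(\<Sum>k\<in>S. c k * v k j) = 0" if "j \<in> J" for j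
      using c0(2) that by (simp add: c_def sum_negf)
    have "\<exists>k\<in>S. c k > 0" using c0(1) unfolding c_def by (auto simp: not_less) (metis less_eq_real_def)
    define T where "T = {k \<in> S. c k > 0}"
    have T: "finite T" "T \<noteq> {}" using S(1) \<open>\<exists>k\<in>S. c k > 0\<close> by (auto simp: T_def)
    \<comment> \<open>The largest multiple of the relation that keeps every coefficient nonnegative;
      the index attaining the minimum drops out of the support.\<close>
    define t where "t = Min ((\<lambda>k. p k / c k) ` T)"
    have "t \<in> (\<lambda>k. p k / c k) ` T" unfolding t_def using T by (intro Min_in) auto
    then obtain k0 where k0: "k0 \<in> T" "t = p k0 / c k0" by blast
    have tle: "t \<le> p k / c k" if "k \<in> T" for k using that T unfolding t_def by auto
    have t0: "t \<ge> 0" using k0 less.prems S(2) by (auto simp: T_def)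
    define q where "q k = (if k \<in> S then p k - t * c k else 0)" for k
    have q0: "0 \<le> q k" if "k \<in> I" for k
    proof (cases "k \<in> S")
      case kS: True
      show ?thesis
      proof (cases "c k > 0")
        case True
        then show ?thesis using tle[of k] kS by (simp add: q_def T_def field_simps)
      next
        case False
        then have "t * c k \<le> 0" using t0 by (simp add: mult_nonneg_nonpos)
        then show ?thesis using less.prems[OF that] by (simp add: q_def)
      qed
    qed (simp add: q_def)
    have "{k \<in> I. q k \<noteq> 0} \<subset> S"
    proof
      show "{k \<in> I. q k \<noteq> 0} \<subseteq> S" by (auto simp: q_def split: if_splits)
      have "q k0 = 0" "k0 \<in> S" using k0 by (auto simp: q_def T_def)
      then show "{k \<in> I. q k \<noteq> 0} \<noteq> S" by auto
    qed
    then have less_card: "card {k \<in> I. q k \<noteq> 0} < card {k \<in> I. p k \<noteq> 0}"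
      using psubset_card_mono[OF S(1)] by (simp add: S_def)
    obtain q' where q': "\<forall>k\<in>I. 0 \<le> q' k" "card {k \<in> I. q' k \<noteq> 0} \<le> card J"
      "\<forall>j\<in>J. (\<Sum>k\<in>I. q' k * v k j) = (\<Sum>k\<in>I. q k * v k j)"
      using less.hyps[OF less_card, OF q0] by blast
    have "(\<Sum>k\<in>I. q k * v k j) = (\<Sum>k\<in>I. p k * v k j)" if "j \<in> J" for j
    proof -
      have "(\<Sum>k\<in>I. q k * v k j) = (\<Sum>k\<in>S. q k * v k j)"
        using S by (intro sum.mono_neutral_right I) (auto simp: q_def)
      also have "\<dots> = (\<Sum>k\<in>S. p k * v k j - t * (c k * v k j))"
        by (intro sum.cong) (auto simp: q_def algebra_simps)
      also have "\<dots> = (\<Sum>k\<in>S. p k * v k j)"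
        by (simp add: sum_subtractf sum_distrib_left[symmetric] c[OF that])
      also have "\<dots> = (\<Sum>k\<in>I. p k * v k j)"
        by (intro sum.mono_neutral_left I S(2)) (auto simp: S_def)
      finally show ?thesis .
    qed
    then show ?thesis using q' by (intro exI[of _ q']) auto
  qed
qed

subsection \<open>Separable matrices\<close>

text \<open>The weights are absorbed into the factors and no trace is prescribed, so the notion is
  stable under local operations that do not preserve the trace.\<close>

definition separable_cone :: "nat \<Rightarrow> nat \<Rightarrow> complex mat \<Rightarrow> bool" where
  "separable_cone m n A \<longleftrightarrow> (\<exists>(N::nat) P Q. (\<forall>k<N. psd m (P k) \<and> psd n (Q k))
     \<and> A = mat (m * n) (m * n) (\<lambda>(i, j). \<Sum>k<N. kron (P k) (Q k) $$ (i, j)))"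

lemma kron_smult_left: "kron (c \<cdot>\<^sub>m A) B = c \<cdot>\<^sub>m kron A B"
proof (rule eq_matI)
  fix i j assume "i < dim_row (c \<cdot>\<^sub>m kron A B)" "j < dim_col (c \<cdot>\<^sub>m kron A B)"
  then have "i < dim_row A * dim_row B" "j < dim_col A * dim_col B" by (auto simp: kron_def)
  then show "kron (c \<cdot>\<^sub>m A) B $$ (i, j) = (c \<cdot>\<^sub>m kron A B) $$ (i, j)"
    by (simp add: kron_def less_mult_imp_div_less)
qed (auto simp: kron_def)

lemma mat_trace_smult: "A \<in> carrier_mat n n \<Longrightarrow> mat_trace (c \<cdot>\<^sub>m A) = c * mat_trace A"
  by (simp add: mat_trace_def sum_distrib_left)

lemma mat_trace_sum_kron:
  assumes "\<And>k. k < N \<Longrightarrow> P k \<in> carrier_mat m m" "\<And>k. k < N \<Longrightarrow> Q k \<in> carrier_mat n n"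
  shows "mat_trace (mat (m * n) (m * n) (\<lambda>(i, j). \<Sum>k<N. c k * kron (P k) (Q k) $$ (i, j)))
    = (\<Sum>k<N. c k * (mat_trace (P k) * mat_trace (Q k)))"
proof -
  have "mat_trace (mat (m * n) (m * n) (\<lambda>(i, j). \<Sum>k<N. c k * kron (P k) (Q k) $$ (i, j)))
     = (\<Sum>k<N. c k * (\<Sum>i<m * n. kron (P k) (Q k) $$ (i, i)))"
    by (simp add: mat_trace_def sum_distrib_left) (rule sum.swap)
  also have "\<dots> = (\<Sum>k<N. c k * mat_trace (kron (P k) (Q k)))"
  proof (rule sum.cong[OF refl])
    fix k assume "k \<in> {..<N}"
    then have "kron (P k) (Q k) \<in> carrier_mat (m * n) (m * n)" using assms by simp
    then show "c k * (\<Sum>i<m * n. kron (P k) (Q k) $$ (i, i)) = c k * mat_trace (kron (P k) (Q k))"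
      by (simp add: mat_trace_def)
  qed
  also have "\<dots> = (\<Sum>k<N. c k * (mat_trace (P k) * mat_trace (Q k)))"
    by (intro sum.cong refl arg_cong2[of _ _ _ _ "(*)"] mat_trace_kron) (use assms in auto)
  finally show ?thesis .
qed

lemma separable_imp_separable_cone:
  assumes "separable m n A"
  shows "separable_cone m n A"
proof -
  from assms obtain N p \<sigma> \<tau> where
    s: "\<forall>k<(N::nat). 0 \<le> p k \<and> density_matrix m (\<sigma> k) \<and> density_matrix n (\<tau> k)" and
    A: "A = mat (m * n) (m * n) (\<lambda>(i, j). \<Sum>k<N. complex_of_real (p k) * kron (\<sigma> k) (\<tau> k) $$ (i, j))"
    unfolding separable_def by blast
  have "\<forall>k<N. psd m (of_real (p k) \<cdot>\<^sub>m \<sigma> k) \<and> psd n (\<tau> k)"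
    using s by (auto simp: density_matrix_iff less_eq_complex_def intro!: psd_smult)
  moreover have "A = mat (m * n) (m * n) (\<lambda>(i, j). \<Sum>k<N. kron (of_real (p k) \<cdot>\<^sub>m \<sigma> k) (\<tau> k) $$ (i, j))"
  proof (rule eq_matI)
    fix i j assume "i < dim_row (mat (m * n) (m * n) (\<lambda>(i, j). \<Sum>k<N. kron (of_real (p k) \<cdot>\<^sub>m \<sigma> k) (\<tau> k) $$ (i, j)))"
      "j < dim_col (mat (m * n) (m * n) (\<lambda>(i, j). \<Sum>k<N. kron (of_real (p k) \<cdot>\<^sub>m \<sigma> k) (\<tau> k) $$ (i, j)))"
    then have ij: "i < m * n" "j < m * n" by auto
    have "dim_row (kron (\<sigma> k) (\<tau> k)) = m * n" "dim_col (kron (\<sigma> k) (\<tau> k)) = m * n" if "k < N" for k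
      using s that by (auto simp: density_matrix_def kron_def)
    then show "A $$ (i, j) = mat (m * n) (m * n) (\<lambda>(i, j). \<Sum>k<N. kron (of_real (p k) \<cdot>\<^sub>m \<sigma> k) (\<tau> k) $$ (i, j)) $$ (i, j)"
      using ij unfolding A by (simp add: kron_smult_left)
  qed (simp_all add: A)
  ultimately show ?thesis unfolding separable_cone_def
    by (intro exI[of _ N] exI[of _ "\<lambda>k. of_real (p k) \<cdot>\<^sub>m \<sigma> k"] exI[of _ \<tau>] conjI)
qed

lemma separable_trace:
  assumes "separable m n A"
  shows "mat_trace A = 1"
proof -
  from assms obtain N p \<sigma> \<tau> where
    s: "\<forall>k<(N::nat). 0 \<le> p k \<and> density_matrix m (\<sigma> k) \<and> density_matrix n (\<tau> k)" and
    p: "(\<Sum>k<N. p k) = 1" and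
    A: "A = mat (m * n) (m * n) (\<lambda>(i, j). \<Sum>k<N. complex_of_real (p k) * kron (\<sigma> k) (\<tau> k) $$ (i, j))"
    unfolding separable_def by blast
  have "mat_trace A = (\<Sum>k<N. of_real (p k) * (mat_trace (\<sigma> k) * mat_trace (\<tau> k)))"
    unfolding A by (rule mat_trace_sum_kron) (use s in \<open>auto simp: density_matrix_def\<close>)
  also have "\<dots> = of_real (\<Sum>k<N. p k)" using s by (auto simp: density_matrix_def)
  finally show ?thesis using p by simp
qed

lemma separable_cone_imp_separable:
  assumes "separable_cone m n A" and tr: "mat_trace A = 1"
  shows "separable m n A"
proof -
  from assms(1) obtain N P Q where
    s: "\<And>k. k < (N::nat) \<Longrightarrow> psd m (P k)" "\<And>k. k < N \<Longrightarrow> psd n (Q k)" and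
    A: "A = mat (m * n) (m * n) (\<lambda>(i, j). \<Sum>k<N. kron (P k) (Q k) $$ (i, j))"
    unfolding separable_cone_def by blast
  have t: "0 \<le> mat_trace (P k)" "0 \<le> mat_trace (Q k)" if "k < N" for k
    using s[OF that] psd_trace_nonneg by auto
  define p where "p k = Re (mat_trace (P k)) * Re (mat_trace (Q k))" for k
  have pt: "of_real (p k) = mat_trace (P k) * mat_trace (Q k)" if "k < N" for k
    using t[OF that] by (auto simp: p_def less_eq_complex_def complex_eq_iff)
  have "mat_trace A = (\<Sum>k<N. 1 * (mat_trace (P k) * mat_trace (Q k)))"
    unfolding A using mat_trace_sum_kron[of N P m Q n "\<lambda>_. 1"] s by (simp add: psd_carrier)
  also have "\<dots> = of_real (\<Sum>k<N. p k)" using pt by simp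
  finally have p1: "(\<Sum>k<N. p k) = 1" using tr by (metis of_real_eq_1_iff)
  \<comment> \<open>A factor of trace zero cannot be normalised, yet its term, of weight zero, still
    needs some density matrix. The normalised factors of a term with nonzero weight serve as this
    placeholder in \<open>nrm\<close>.\<close>
  then obtain k0 where k0: "k0 < N" "p k0 \<noteq> 0" by (metis lessThan_iff sum.neutral zero_neq_one)
  define nrm where "nrm X Y = (if mat_trace Y = 0 then inverse (mat_trace X) \<cdot>\<^sub>m X else inverse (mat_trace Y) \<cdot>\<^sub>m Y)"
    for X Y :: "complex mat"
  have nrm: "density_matrix r (nrm X Y)" if "psd r X" "psd r Y" "mat_trace X \<noteq> 0" for r X Y
    using that psd_trace_nonneg[OF that(1)] psd_trace_nonneg[OF that(2)] psd_carrier[OF that(1)] psd_carrier[OF that(2)]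
    by (auto simp: density_matrix_iff nrm_def mat_trace_smult less_eq_complex_def
        intro!: psd_smult divide_nonneg_nonneg)
  define \<sigma> where "\<sigma> k = nrm (P k0) (P k)" for k
  define \<tau> where "\<tau> k = nrm (Q k0) (Q k)" for k
  have dens: "density_matrix m (\<sigma> k)" "density_matrix n (\<tau> k)" if "k < N" for k
    unfolding \<sigma>_def \<tau>_def
    by (rule nrm[OF s(1)[OF k0(1)] s(1)[OF that]], use k0(2) in \<open>auto simp: p_def\<close>)
      (rule nrm[OF s(2)[OF k0(1)] s(2)[OF that]], use k0(2) in \<open>auto simp: p_def\<close>)
  have e: "kron (P k) (Q k) $$ (i * n + i', j * n + j') = of_real (p k) * kron (\<sigma> k) (\<tau> k) $$ (i * n + i', j * n + j')"
    if "k < N" "i < m" "i' < n" "j < m" "j' < n" for k i i' j j'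
  proof -
    have P: "P k \<in> carrier_mat m m" and Q: "Q k \<in> carrier_mat n n" using s[OF that(1)] psd_carrier by auto
    have S: "\<sigma> k \<in> carrier_mat m m" and T: "\<tau> k \<in> carrier_mat n n"
      using dens[OF that(1)] by (auto simp: density_matrix_def)
    have "P k $$ (i, j) = mat_trace (P k) * \<sigma> k $$ (i, j)"
      using psd_trace_zero[OF s(1)[OF that(1)]] P that by (auto simp: \<sigma>_def nrm_def)
    moreover have "Q k $$ (i', j') = mat_trace (Q k) * \<tau> k $$ (i', j')"
      using psd_trace_zero[OF s(2)[OF that(1)]] Q that by (auto simp: \<tau>_def nrm_def)
    ultimately show ?thesis
      unfolding pt[OF that(1)] kron_entry[OF P Q that(2,3,4,5)] kron_entry[OF S T that(2,3,4,5)]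
      by (simp only: mult_ac)
  qed
  have "A = mat (m * n) (m * n) (\<lambda>(i, j). \<Sum>k<N. complex_of_real (p k) * kron (\<sigma> k) (\<tau> k) $$ (i, j))"
    unfolding A by (rule eq_mat_pairI) (auto simp: pair_index_less e)
  moreover have "0 \<le> p k" if "k < N" for k using t[OF that] by (simp add: p_def less_eq_complex_def)
  ultimately show ?thesis
    unfolding separable_def using dens p1 by blast
qed

text \<open>The bound is the number of real coordinates of a matrix of size \<open>m * n\<close>.\<close>

lemma separable_bounded_length:
  assumes "separable m n A"
  shows "\<exists>P Q. (\<forall>k<2 * (m * n)\<^sup>2. psd m (P k) \<and> psd n (Q k)
        \<and> Re (mat_trace (P k)) \<le> 1 \<and> Re (mat_trace (Q k)) \<le> 1)
     \<and> A = mat (m * n) (m * n) (\<lambda>(i, j). \<Sum>k<2 * (m * n)\<^sup>2. kron (P k) (Q k) $$ (i, j))"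
proof -
  let ?D = "2 * (m * n)\<^sup>2"
  from assms obtain N p \<sigma> \<tau> where
    s: "\<And>k. k < (N::nat) \<Longrightarrow> 0 \<le> p k" "\<And>k. k < N \<Longrightarrow> density_matrix m (\<sigma> k)"
      "\<And>k. k < N \<Longrightarrow> density_matrix n (\<tau> k)" and
    A: "A = mat (m * n) (m * n) (\<lambda>(i, j). \<Sum>k<N. complex_of_real (p k) * kron (\<sigma> k) (\<tau> k) $$ (i, j))"
    unfolding separable_def by blast
  \<comment> \<open>Real coordinates of the product terms, because the coefficients must stay real
    and nonnegative: the flag selects the real or the imaginary part.\<close>
  define v where "v k = (\<lambda>(c, i, j). (if c then Re else Im) (kron (\<sigma> k) (\<tau> k) $$ (i, j)))" for k
  define J where "J = (UNIV :: bool set) \<times> {..<m * n} \<times> {..<m * n}"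
  have J: "finite J" "card J = ?D" by (auto simp: J_def card_cartesian_product power2_eq_square)
  obtain q where q: "\<forall>k\<in>{..<N}. 0 \<le> q k" "\<forall>j\<in>J. (\<Sum>k<N. q k * v k j) = (\<Sum>k<N. p k * v k j)"
    "card {k \<in> {..<N}. q k \<noteq> 0} \<le> card J"
    using conic_caratheodory[OF finite_lessThan[of N] J(1), of p v] s(1) by auto
  have Aq: "A = mat (m * n) (m * n) (\<lambda>(i, j). \<Sum>k<N. complex_of_real (q k) * kron (\<sigma> k) (\<tau> k) $$ (i, j))"
  proof (unfold A, rule cong_mat[OF refl refl])
    fix i j assume ij: "i < m * n" "j < m * n"
    have "(\<Sum>k<N. q k * v k (c, i, j)) = (\<Sum>k<N. p k * v k (c, i, j))" for c
      using q(2) ij by (auto simp: J_def)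
    from this[of True] this[of False]
    show "(case (i, j) of (i, j) \<Rightarrow> \<Sum>k<N. complex_of_real (p k) * kron (\<sigma> k) (\<tau> k) $$ (i, j))
        = (case (i, j) of (i, j) \<Rightarrow> \<Sum>k<N. complex_of_real (q k) * kron (\<sigma> k) (\<tau> k) $$ (i, j))"
      by (simp add: v_def complex_eq_iff)
  qed
  \<comment> \<open>The reduction for cones does not record the sum of the weights. It is recovered
    from the trace of \<open>A\<close>, since all product terms have trace 1.\<close>
  have "1 = (\<Sum>k<N. complex_of_real (q k) * (mat_trace (\<sigma> k) * mat_trace (\<tau> k)))"
    unfolding separable_trace[OF assms, symmetric]
    unfolding Aq by (rule mat_trace_sum_kron) (use s in \<open>auto simp: density_matrix_def\<close>)
  also have "\<dots> = of_real (\<Sum>k<N. q k)" using s by (auto simp: density_matrix_def)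
  finally have q1: "(\<Sum>k<N. q k) = 1" by (metis of_real_eq_1_iff)
  define S where "S = {k \<in> {..<N}. q k \<noteq> 0}"
  have S: "finite S" "card S \<le> ?D" using q(3) J by (auto simp: S_def)
  obtain h where h: "bij_betw h {0..<card S} S" using ex_bij_betw_nat_finite[OF S(1)] by blast
  have hS: "h k < N" if "k < card S" for k using h that by (auto simp: bij_betw_def S_def)
  \<comment> \<open>The weight goes into the first factor, which keeps both traces at most 1. Zero
    terms pad the sum to a length depending only on the dimensions.\<close>
  define P where "P k = (if k < card S then of_real (q (h k)) \<cdot>\<^sub>m \<sigma> (h k) else 0\<^sub>m m m)" for k
  define Q where "Q k = (if k < card S then \<tau> (h k) else 0\<^sub>m n n)" for k
  have "psd m (P k) \<and> psd n (Q k) \<and> Re (mat_trace (P k)) \<le> 1 \<and> Re (mat_trace (Q k)) \<le> 1" for k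
  proof (cases "k < card S")
    case True
    have "q (h k) \<le> (\<Sum>k<N. q k)" using hS[OF True] q(1) by (intro member_le_sum) auto
    then show ?thesis
      using True hS[OF True] s(2,3)[of "h k"] q
      by (auto simp: P_def Q_def q1 density_matrix_iff mat_trace_smult[OF psd_carrier] less_eq_complex_def intro!: psd_smult)
  next
    case False
    then show ?thesis by (simp add: P_def Q_def psd_zero) (simp add: mat_trace_def)
  qed
  moreover have "A = mat (m * n) (m * n) (\<lambda>(i, j). \<Sum>k<?D. kron (P k) (Q k) $$ (i, j))"
  proof (unfold Aq, rule cong_mat[OF refl refl], unfold prod.case)
    fix i j assume ij: "i < m * n" "j < m * n"
    have "(\<Sum>k<N. complex_of_real (q k) * kron (\<sigma> k) (\<tau> k) $$ (i, j))
       = (\<Sum>k\<in>S. complex_of_real (q k) * kron (\<sigma> k) (\<tau> k) $$ (i, j))"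
      by (intro sum.mono_neutral_right) (auto simp: S_def)
    also have "\<dots> = (\<Sum>k\<in>{0..<card S}. complex_of_real (q (h k)) * kron (\<sigma> (h k)) (\<tau> (h k)) $$ (i, j))"
      by (rule sum.reindex_bij_betw[OF h, symmetric])
    also have "\<dots> = (\<Sum>k\<in>{0..<card S}. kron (P k) (Q k) $$ (i, j))"
    proof (rule sum.cong[OF refl])
      fix k assume k: "k \<in> {0..<card S}"
      have "kron (\<sigma> (h k)) (\<tau> (h k)) \<in> carrier_mat (m * n) (m * n)"
        using s(2,3)[OF hS[of k]] k by (auto simp: density_matrix_def)
      then show "complex_of_real (q (h k)) * kron (\<sigma> (h k)) (\<tau> (h k)) $$ (i, j) = kron (P k) (Q k) $$ (i, j)"
        using k ij by (simp add: P_def Q_def kron_smult_left)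
    qed
    also have "\<dots> = (\<Sum>k<?D. kron (P k) (Q k) $$ (i, j))"
    proof (rule sum.mono_neutral_left)
      show "\<forall>k\<in>{..<?D} - {0..<card S}. kron (P k) (Q k) $$ (i, j) = 0"
      proof
        fix k assume "k \<in> {..<?D} - {0..<card S}"
        then have e: "P k = 0\<^sub>m m m" "Q k = 0\<^sub>m n n" by (auto simp: P_def Q_def)
        obtain i1 i2 where i: "i1 < m" "i2 < n" "i = i1 * n + i2" using pair_index_cases[OF ij(1)] .
        obtain j1 j2 where j: "j1 < m" "j2 < n" "j = j1 * n + j2" using pair_index_cases[OF ij(2)] .
        show "kron (P k) (Q k) $$ (i, j) = 0"
          unfolding e i j kron_entry[OF zero_carrier_mat zero_carrier_mat i(1,2) j(1,2)] using i j by simp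
      qed
    qed (use S in auto)
    finally show "(\<Sum>k<N. complex_of_real (q k) * kron (\<sigma> k) (\<tau> k) $$ (i, j)) = (\<Sum>k<?D. kron (P k) (Q k) $$ (i, j))" .
  qed
  ultimately show ?thesis by (intro exI[of _ P] exI[of _ Q] conjI) blast
qed

section \<open>Compactness and closedness of the set of separable states\<close>

text \<open>Each sequence is thinned to a monotone, hence convergent, one. Further thinning
  preserves the limits already obtained, so finitely many sequences share one subsequence.\<close>

lemma finite_real_family_convergent_subsequence:
  fixes f :: "'a \<Rightarrow> nat \<Rightarrow> real"
  assumes "finite I" "\<And>i. i \<in> I \<Longrightarrow> Bseq (f i)"
  shows "\<exists>r. strict_mono r \<and> (\<forall>i\<in>I. convergent (\<lambda>t. f i (r t)))"
  using assms
proof (induction I rule: finite_induct)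
  case empty
  show ?case by (intro exI[of _ id]) (auto simp: strict_mono_def)
next
  case (insert a I)
  then have "\<exists>r. strict_mono r \<and> (\<forall>i\<in>I. convergent (\<lambda>t. f i (r t)))" by blast
  then obtain r where r: "strict_mono r" "\<And>i. i \<in> I \<Longrightarrow> convergent (\<lambda>t. f i (r t))" by blast
  obtain s where s: "strict_mono s" "monoseq (\<lambda>t. f a (r (s t)))"
    using seq_monosub[of "\<lambda>t. f a (r t)"] by blast
  have "Bseq (\<lambda>t. f a (r (s t)))"
    using Bseq_subseq[OF insert.prems[of a], of "\<lambda>t. r (s t)"] by simp
  then have a: "convergent (\<lambda>t. f a (r (s t)))" using s(2) by (rule Bseq_monoseq_convergent)
  have "convergent (\<lambda>t. f i (r (s t)))" if "i \<in> I" for i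
    using convergent_subseq_convergent[OF r(2)[OF that] s(1)] by (simp add: o_def)
  with a have "\<forall>i\<in>insert a I. convergent (\<lambda>t. f i ((r \<circ> s) t))" by simp
  then show ?case using strict_mono_o[OF r(1) s(1)] by blast
qed

lemma finite_complex_family_convergent_subsequence:
  fixes f :: "'a \<Rightarrow> nat \<Rightarrow> complex"
  assumes "finite I" "\<And>i t. i \<in> I \<Longrightarrow> cmod (f i t) \<le> c"
  shows "\<exists>r. strict_mono r \<and> (\<forall>i\<in>I. convergent (\<lambda>t. f i (r t)))"
proof -
  define g where "g = (\<lambda>(b, i) t. (if b then Re else Im) (f i t))"
  have "Bseq (g x)" if "x \<in> UNIV \<times> I" for x
  proof (rule BseqI')
    fix t
    show "norm (g x t) \<le> c"
      using that order_trans[OF abs_Re_le_cmod assms(2)] order_trans[OF abs_Im_le_cmod assms(2)]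
      by (auto simp: g_def)
  qed
  moreover have "finite ((UNIV :: bool set) \<times> I)" using assms(1) by simp
  ultimately obtain r where r: "strict_mono r" "\<And>x. x \<in> UNIV \<times> I \<Longrightarrow> convergent (\<lambda>t. g x (r t))"
    using finite_real_family_convergent_subsequence[of "UNIV \<times> I" g] by blast
  have "convergent (\<lambda>t. f i (r t))" if i: "i \<in> I" for i
  proof -
    obtain x where x: "(\<lambda>t. Re (f i (r t))) \<longlonglongrightarrow> x"
      using r(2)[of "(True, i)"] i by (auto simp: g_def convergent_def)
    obtain y where "(\<lambda>t. Im (f i (r t))) \<longlonglongrightarrow> y"
      using r(2)[of "(False, i)"] i by (auto simp: g_def convergent_def)
    with x have "(\<lambda>t. f i (r t)) \<longlonglongrightarrow> Complex x y" by (simp add: tendsto_complex_iff)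
    then show ?thesis by (rule convergentI)
  qed
  then show ?thesis using r(1) by blast
qed

lemma separable_closed:
  assumes sep: "\<And>t. separable m n (A t)" and L: "L \<in> carrier_mat (m * n) (m * n)"
    and lim: "\<And>i j. i < m * n \<Longrightarrow> j < m * n \<Longrightarrow> (\<lambda>t. A t $$ (i, j)) \<longlonglongrightarrow> L $$ (i, j)"
  shows "separable m n L"
proof -
  define D where "D = 2 * (m * n)\<^sup>2"
  have "\<forall>t. \<exists>P Q. (\<forall>k<D. psd m (P k) \<and> psd n (Q k)
        \<and> Re (mat_trace (P k)) \<le> 1 \<and> Re (mat_trace (Q k)) \<le> 1)
     \<and> A t = mat (m * n) (m * n) (\<lambda>(i, j). \<Sum>k<D. kron (P k) (Q k) $$ (i, j))"
    unfolding D_def using separable_bounded_length[OF sep] by blast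
  then obtain P Q where
    P: "\<And>t k. k < D \<Longrightarrow> psd m (P t k)" "\<And>t k. k < D \<Longrightarrow> Re (mat_trace (P t k)) \<le> 1" and
    Q: "\<And>t k. k < D \<Longrightarrow> psd n (Q t k)" "\<And>t k. k < D \<Longrightarrow> Re (mat_trace (Q t k)) \<le> 1" and
    A: "\<And>t. A t = mat (m * n) (m * n) (\<lambda>(i, j). \<Sum>k<D. kron (P t k) (Q t k) $$ (i, j))"
    unfolding choice_iff by blast
  define f where "f = (\<lambda>(c, k, i, j) t. (if c then P t k else Q t k) $$ (i, j))"
  \<comment> \<open>The flag merges the entries of all first and second factors into a single finite
    family, so that one subsequence serves both. Finiteness rests on \<open>D\<close> being the same
    for every \<open>t\<close>.\<close>
  define I where "I = {True} \<times> {..<D} \<times> {..<m} \<times> {..<m} \<union> {False} \<times> {..<D} \<times> {..<n} \<times> {..<n}"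
  have "cmod (f x t) \<le> 1" if x: "x \<in> I" for x t
  proof -
      have "cmod (P t k $$ (i, j)) \<le> 1" if "k < D" "i < m" "j < m" for k i j
        using psd_entry_le_trace[OF P(1)[OF that(1)] that(2,3)] P(2)[OF that(1)] by (rule order_trans)
      moreover have "cmod (Q t k $$ (i, j)) \<le> 1" if "k < D" "i < n" "j < n" for k i j
        using psd_entry_le_trace[OF Q(1)[OF that(1)] that(2,3)] Q(2)[OF that(1)] by (rule order_trans)
      ultimately show ?thesis using x by (auto simp: I_def f_def)
  qed
  moreover have "finite I" by (auto simp: I_def)
  ultimately obtain r where r: "strict_mono r" "\<And>x. x \<in> I \<Longrightarrow> convergent (\<lambda>t. f x (r t))"
    using finite_complex_family_convergent_subsequence[of I f] by blast
  define g where "g x = lim (\<lambda>t. f x (r t))" for x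
  have g: "(\<lambda>t. f x (r t)) \<longlonglongrightarrow> g x" if "x \<in> I" for x
    using r(2)[OF that] by (simp add: g_def convergent_LIMSEQ_iff)
  define P' where "P' k = mat m m (\<lambda>(i, j). g (True, k, i, j))" for k
  define Q' where "Q' k = mat n n (\<lambda>(i, j). g (False, k, i, j))" for k
  have limP: "(\<lambda>t. P (r t) k $$ (i, j)) \<longlonglongrightarrow> P' k $$ (i, j)" if "k < D" "i < m" "j < m" for i j k
    using g[of "(True, k, i, j)"] that by (simp add: I_def f_def P'_def o_def)
  have limQ: "(\<lambda>t. Q (r t) k $$ (i, j)) \<longlonglongrightarrow> Q' k $$ (i, j)" if "k < D" "i < n" "j < n" for i j k
    using g[of "(False, k, i, j)"] that by (simp add: I_def f_def Q'_def o_def)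
  have PC: "P' k \<in> carrier_mat m m" and QC: "Q' k \<in> carrier_mat n n" for k by (auto simp: P'_def Q'_def)
  have psd': "psd m (P' k) \<and> psd n (Q' k)" if "k < D" for k
    using psd_closed[OF P(1)[OF that] PC limP[OF that]] psd_closed[OF Q(1)[OF that] QC limQ[OF that]] by blast
  have limA: "(\<lambda>t. A (r t) $$ (i, j)) \<longlonglongrightarrow> L $$ (i, j)" if "i < m * n" "j < m * n" for i j
    using LIMSEQ_subseq_LIMSEQ[OF lim[OF that] r(1)] by (simp add: o_def)
  have "L = mat (m * n) (m * n) (\<lambda>(i, j). \<Sum>k<D. kron (P' k) (Q' k) $$ (i, j))"
  proof (rule eq_mat_pairI[OF L])
    fix i k j l assume *: "i < m" "k < n" "j < m" "l < n"
    have "(\<lambda>t. \<Sum>s<D. P (r t) s $$ (i, j) * Q (r t) s $$ (k, l)) \<longlonglongrightarrow> (\<Sum>s<D. P' s $$ (i, j) * Q' s $$ (k, l))"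
      using * by (intro tendsto_sum tendsto_mult limP limQ) auto
    moreover have "(\<Sum>s<D. P (r t) s $$ (i, j) * Q (r t) s $$ (k, l)) = A (r t) $$ (i * n + k, j * n + l)" for t
    proof -
      have "P (r t) s $$ (i, j) * Q (r t) s $$ (k, l) = kron (P (r t) s) (Q (r t) s) $$ (i * n + k, j * n + l)"
        if "s < D" for s
        using kron_entry[OF psd_carrier[OF P(1)[OF that]] psd_carrier[OF Q(1)[OF that]]] * by simp
      then show ?thesis unfolding A using * by (simp add: pair_index_less)
    qed
    ultimately have "(\<lambda>t. A (r t) $$ (i * n + k, j * n + l)) \<longlonglongrightarrow> (\<Sum>s<D. P' s $$ (i, j) * Q' s $$ (k, l))" by simp
    then have "L $$ (i * n + k, j * n + l) = (\<Sum>s<D. P' s $$ (i, j) * Q' s $$ (k, l))"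
      using LIMSEQ_unique[OF limA] * by (simp add: pair_index_less)
    then show "L $$ (i * n + k, j * n + l)
        = mat (m * n) (m * n) (\<lambda>(i, j). \<Sum>k<D. kron (P' k) (Q' k) $$ (i, j)) $$ (i * n + k, j * n + l)"
      using * by (simp add: pair_index_less kron_entry[OF PC QC])
  qed simp
  then have "separable_cone m n L" using psd' unfolding separable_cone_def by blast
  moreover have "mat_trace L = 1"
  proof -
    have "(\<lambda>t. \<Sum>i<m * n. A t $$ (i, i)) \<longlonglongrightarrow> (\<Sum>i<m * n. L $$ (i, i))"
      by (intro tendsto_sum lim) auto
    moreover have "(\<Sum>i<m * n. A t $$ (i, i)) = 1" for t
      using separable_trace[OF sep[of t]] by (simp add: mat_trace_def A)
    ultimately show ?thesis using L by (simp add: mat_trace_def LIMSEQ_const_iff)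
  qed
  ultimately show ?thesis by (rule separable_cone_imp_separable)
qed

section \<open>Decay of orbits under a matrix with spectrum inside the unit disc\<close>

lemma mult_mat_vec_entry:
  assumes "A \<in> carrier_mat n m" "v \<in> carrier_vec m" "i < n"
  shows "(A *\<^sub>v v) $ i = (\<Sum>j<m. A $$ (i, j) * v $ j)"
  using assms by (simp add: scalar_prod_def lessThan_atLeast0)

text \<open>Powers of a matrix with spectral radius below 1 have bounded entries. Applying this to
  \<open>M / r\<close>, with \<open>r\<close> strictly between the spectral radius of
  \<open>M\<close> and 1, gives a bound \<open>C * r ^ m\<close> on the orbit.\<close>

lemma orbit_tendsto_zero:
  fixes M :: "complex mat"
  assumes M: "M \<in> carrier_mat N N" and ev: "\<And>z. eigenvalue M z \<Longrightarrow> cmod z < 1"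
    and x: "\<And>m. x m \<in> carrier_vec N" "\<And>m. M *\<^sub>v x m = x (Suc m)" and i: "i < N"
  shows "(\<lambda>m. x m $ i) \<longlonglongrightarrow> 0"
proof -
  have N: "N > 0" using i by simp
  define s where "s = spectral_radius M"
  obtain z where z: "z \<in> spectrum M" "s = cmod z"
    using spectral_radius_mem_max(1)[OF M N] by (auto simp: s_def)
  have s: "0 \<le> s" "s < 1" using z ev by (auto simp: spectrum_def)
  define r where "r = (s + 1) / 2"
  have r: "0 < r" "r < 1" "s < r" using s by (auto simp: r_def)
  define S where "S = inverse (complex_of_real r) \<cdot>\<^sub>m M"
  have S: "S \<in> carrier_mat N N" using M by (simp add: S_def)
  have "spectral_radius S < 1"
  proof -
    obtain k where k: "k \<in> spectrum S" "spectral_radius S = cmod k"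
      using spectral_radius_mem_max(1)[OF S N] by auto
    then obtain v where v: "v \<in> carrier_vec N" "v \<noteq> 0\<^sub>v N" "S *\<^sub>v v = k \<cdot>\<^sub>v v"
      using S by (auto simp: spectrum_def eigenvalue_def eigenvector_def)
    have "S *\<^sub>v v = inverse (complex_of_real r) \<cdot>\<^sub>v (M *\<^sub>v v)" unfolding S_def using M v(1) by auto
    then have "M *\<^sub>v v = complex_of_real r \<cdot>\<^sub>v (S *\<^sub>v v)"
      using r(1) by (simp add: smult_smult_assoc)
    then have "M *\<^sub>v v = (of_real r * k) \<cdot>\<^sub>v v" unfolding v(3) by (simp add: smult_smult_assoc)
    then have "of_real r * k \<in> spectrum M"
      using v M by (auto simp: spectrum_def eigenvalue_def eigenvector_def)
    then have "cmod (of_real r * k) \<le> s" unfolding s_def by (intro spectral_radius_mem_max(2)[OF M N]) auto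
    then have "r * cmod k \<le> s" using r(1) by (simp add: norm_mult)
    then have "r * cmod k < r * 1" using r(3) by simp
    then show ?thesis unfolding k(2) using mult_less_cancel_left_pos[OF r(1)] by blast
  qed
  then obtain c where c: "\<And>m. norm_bound (S ^\<^sub>m m) c"
    using spectral_radius_jnf_norm_bound_less_1_upper_triangular[OF S] by blast
  have pow: "S ^\<^sub>m m *\<^sub>v x n = inverse (complex_of_real r) ^ m \<cdot>\<^sub>v x (n + m)" for m n
  proof (induction m arbitrary: n)
    case 0
    then show ?case using S x(1)[of n] by simp
  next
    case (Suc m)
    have Sm: "S ^\<^sub>m m \<in> carrier_mat N N" using S by simp
    have Sx: "S *\<^sub>v x n = inverse (complex_of_real r) \<cdot>\<^sub>v x (Suc n)"
      unfolding S_def x(2)[symmetric] using M x(1)[of n] by auto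
    have "S ^\<^sub>m Suc m *\<^sub>v x n = S ^\<^sub>m m *\<^sub>v (S *\<^sub>v x n)"
      using assoc_mult_mat_vec[OF Sm S x(1)] by simp
    also have "\<dots> = inverse (complex_of_real r) \<cdot>\<^sub>v (S ^\<^sub>m m *\<^sub>v x (Suc n))"
      unfolding Sx by (rule mult_mat_vec[OF Sm x(1)])
    finally show ?case by (simp add: Suc.IH smult_smult_assoc)
  qed
  define C where "C = (\<Sum>j<N. c * cmod (x 0 $ j))"
  have "cmod (x m $ i) \<le> C * r ^ m" for m
  proof -
    have Sm: "S ^\<^sub>m m \<in> carrier_mat N N" using S by simp
    have "cmod ((S ^\<^sub>m m *\<^sub>v x 0) $ i) = cmod (\<Sum>j<N. (S ^\<^sub>m m) $$ (i, j) * x 0 $ j)"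
      by (simp only: mult_mat_vec_entry[OF Sm x(1) i])
    also have "\<dots> \<le> (\<Sum>j<N. cmod ((S ^\<^sub>m m) $$ (i, j) * x 0 $ j))" by (rule norm_sum)
    also have "\<dots> \<le> C" unfolding C_def
    proof (rule sum_mono)
      fix j assume j: "j \<in> {..<N}"
      have "cmod ((S ^\<^sub>m m) $$ (i, j)) \<le> c"
        using c[of m] i j unfolding norm_bound_def carrier_matD[OF Sm] by blast
      then show "cmod ((S ^\<^sub>m m) $$ (i, j) * x 0 $ j) \<le> c * cmod (x 0 $ j)"
        by (simp add: norm_mult mult_right_mono)
    qed
    finally have "cmod (inverse (complex_of_real r) ^ m * x m $ i) \<le> C"
      using x(1)[of m] i by (simp add: pow)
    then have "inverse r ^ m * cmod (x m $ i) \<le> C" using r(1) by (simp add: norm_mult norm_power norm_inverse)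
    then show ?thesis using r(1) by (simp add: power_inverse field_simps)
  qed
  then have le: "norm (x m $ i) \<le> norm (C * r ^ m) * 1" for m
    using abs_ge_self[of "C * r ^ m"] by (simp only: real_norm_def mult_1_right) (rule order_trans)
  have "(\<lambda>m. C * r ^ m) \<longlonglongrightarrow> C * 0"
    using r by (intro tendsto_intros LIMSEQ_realpow_zero) auto
  then have "(\<lambda>m. C * r ^ m) \<longlonglongrightarrow> 0" by simp
  then show ?thesis by (rule tendsto_0_le) (use le in \<open>intro always_eventually allI\<close>)
qed

subsection \<open>Sums of matrices and operations on the separable cone\<close>

text \<open>The dimensions are passed explicitly, so that the empty sum is the zero matrix of the
  intended size.\<close>

definition mat_sum :: "nat \<Rightarrow> nat \<Rightarrow> nat \<Rightarrow> (nat \<Rightarrow> complex mat) \<Rightarrow> complex mat" where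
  "mat_sum r c N F = mat r c (\<lambda>(i, j). \<Sum>k<N. F k $$ (i, j))"

lemma mat_sum_carrier [simp]: "mat_sum r c N F \<in> carrier_mat r c"
  by (simp add: mat_sum_def)

lemma mat_sum_cong:
  "(\<And>k. k < N \<Longrightarrow> F k = G k) \<Longrightarrow> mat_sum r c N F = mat_sum r c N G"
  unfolding mat_sum_def by (rule cong_mat) auto

lemma mult_mat_sum:
  assumes A: "A \<in> carrier_mat p r" and F: "\<And>k. k < N \<Longrightarrow> F k \<in> carrier_mat r c"
  shows "A * mat_sum r c N F = mat_sum p c N (\<lambda>k. A * F k)"
proof (rule eq_matI)
  fix i j assume "i < dim_row (mat_sum p c N (\<lambda>k. A * F k))" "j < dim_col (mat_sum p c N (\<lambda>k. A * F k))"
  then have ij: "i < p" "j < c" by (auto simp: mat_sum_def)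
  have "(A * mat_sum r c N F) $$ (i, j) = (\<Sum>l<r. \<Sum>k<N. A $$ (i, l) * F k $$ (l, j))"
    unfolding mult_mat_entry[OF A mat_sum_carrier ij] using ij by (simp add: mat_sum_def sum_distrib_left)
  also have "\<dots> = (\<Sum>k<N. \<Sum>l<r. A $$ (i, l) * F k $$ (l, j))" by (rule sum.swap)
  also have "\<dots> = (\<Sum>k<N. (A * F k) $$ (i, j))"
    by (intro sum.cong refl mult_mat_entry[OF A F ij, symmetric]) auto
  finally show "(A * mat_sum r c N F) $$ (i, j) = mat_sum p c N (\<lambda>k. A * F k) $$ (i, j)"
    using ij by (simp add: mat_sum_def del: index_mult_mat)
qed (use A in \<open>auto simp: mat_sum_def\<close>)

lemma mat_sum_mult:
  assumes A: "A \<in> carrier_mat c p" and F: "\<And>k. k < N \<Longrightarrow> F k \<in> carrier_mat r c"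
  shows "mat_sum r c N F * A = mat_sum r p N (\<lambda>k. F k * A)"
proof (rule eq_matI)
  fix i j assume "i < dim_row (mat_sum r p N (\<lambda>k. F k * A))" "j < dim_col (mat_sum r p N (\<lambda>k. F k * A))"
  then have ij: "i < r" "j < p" by (auto simp: mat_sum_def)
  have "(mat_sum r c N F * A) $$ (i, j) = (\<Sum>l<c. \<Sum>k<N. F k $$ (i, l) * A $$ (l, j))"
    unfolding mult_mat_entry[OF mat_sum_carrier A ij] using ij by (simp add: mat_sum_def sum_distrib_right)
  also have "\<dots> = (\<Sum>k<N. \<Sum>l<c. F k $$ (i, l) * A $$ (l, j))" by (rule sum.swap)
  also have "\<dots> = (\<Sum>k<N. (F k * A) $$ (i, j))"
    by (intro sum.cong refl mult_mat_entry[OF F A ij, symmetric]) auto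
  finally show "(mat_sum r c N F * A) $$ (i, j) = mat_sum r p N (\<lambda>k. F k * A) $$ (i, j)"
    using ij by (simp add: mat_sum_def del: index_mult_mat)
qed (use A in \<open>auto simp: mat_sum_def\<close>)

lemma kron_mat_sum:
  assumes B: "B \<in> carrier_mat p q" and F: "\<And>k. k < N \<Longrightarrow> F k \<in> carrier_mat r c"
  shows "kron (mat_sum r c N F) B = mat_sum (r * p) (c * q) N (\<lambda>k. kron (F k) B)"
proof (rule eq_mat_pairI)
  show "kron (mat_sum r c N F) B \<in> carrier_mat (r * p) (c * q)" using B by simp
  fix i k j l assume *: "i < r" "k < p" "j < c" "l < q"
  have "kron (F s) B $$ (i * p + k, j * q + l) = F s $$ (i, j) * B $$ (k, l)" if "s < N" for s
    by (rule kron_entry[OF F[OF that] B *])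
  then show "kron (mat_sum r c N F) B $$ (i * p + k, j * q + l)
      = mat_sum (r * p) (c * q) N (\<lambda>k. kron (F k) B) $$ (i * p + k, j * q + l)"
    unfolding kron_entry[OF mat_sum_carrier B *] using *
    by (simp add: mat_sum_def pair_index_less sum_distrib_right)
qed simp

lemma ptrace2_mat_sum:
  "ptrace2 m n (mat_sum (m * n) (m * n) N F) = mat_sum m m N (\<lambda>k. ptrace2 m n (F k))"
proof (rule eq_matI)
  fix i j assume "i < dim_row (mat_sum m m N (\<lambda>k. ptrace2 m n (F k)))" "j < dim_col (mat_sum m m N (\<lambda>k. ptrace2 m n (F k)))"
  then have ij: "i < m" "j < m" by (auto simp: mat_sum_def)
  then show "ptrace2 m n (mat_sum (m * n) (m * n) N F) $$ (i, j) = mat_sum m m N (\<lambda>k. ptrace2 m n (F k)) $$ (i, j)"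
    by (simp add: ptrace2_def mat_sum_def pair_index_less) (rule sum.swap)
qed (auto simp: mat_sum_def ptrace2_def)

lemma separable_coneI:
  "(\<And>k. k < N \<Longrightarrow> psd m (P k) \<and> psd n (Q k)) \<Longrightarrow>
   separable_cone m n (mat_sum (m * n) (m * n) N (\<lambda>k. kron (P k) (Q k)))"
  unfolding separable_cone_def mat_sum_def by blast

lemma separable_coneE:
  assumes "separable_cone m n A"
  obtains N P Q where "\<And>k. k < N \<Longrightarrow> psd m (P k)" "\<And>k. k < N \<Longrightarrow> psd n (Q k)"
    "A = mat_sum (m * n) (m * n) N (\<lambda>k. kron (P k) (Q k))"
  using assms unfolding separable_cone_def mat_sum_def by blast

text \<open>Associativity of \<open>kron\<close> hands the additional factor to the second party,
  term by term.\<close>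

lemma separable_cone_kron:
  assumes "separable_cone m n A" and B: "psd b B"
  shows "separable_cone m (n * b) (kron A B)"
proof -
  from assms(1) obtain N P Q where s: "\<And>k. k < N \<Longrightarrow> psd m (P k)" "\<And>k. k < N \<Longrightarrow> psd n (Q k)"
    and A: "A = mat_sum (m * n) (m * n) N (\<lambda>k. kron (P k) (Q k))" by (rule separable_coneE) blast
  have c: "\<And>k. k < N \<Longrightarrow> P k \<in> carrier_mat m m" "\<And>k. k < N \<Longrightarrow> Q k \<in> carrier_mat n n" "B \<in> carrier_mat b b"
    using s B psd_carrier by auto
  have "kron A B = mat_sum (m * n * b) (m * n * b) N (\<lambda>k. kron (kron (P k) (Q k)) B)"
    unfolding A by (rule kron_mat_sum[OF c(3)]) (use c in auto)
  also have "\<dots> = mat_sum (m * (n * b)) (m * (n * b)) N (\<lambda>k. kron (P k) (kron (Q k) B))"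
    unfolding mult.assoc by (rule mat_sum_cong) (rule kron_assoc[OF c(1) c(2) c(3)])
  finally have *: "kron A B = \<dots>" .
  show ?thesis unfolding * by (rule separable_coneI) (use s B psd_kron in blast)
qed

text \<open>\<open>K\<close> may be rectangular and acts on the second party only. The lemma is used
  twice: with the adjoint of \<open>fcs_W\<close>, to spread the memory over the chain, and with
  \<open>fcs_W\<close> itself, to recover it.\<close>

lemma separable_cone_congruence:
  assumes "separable_cone m n A" and K: "K \<in> carrier_mat p n"
  shows "separable_cone m p (kron (1\<^sub>m m) K * A * mat_adjoint (kron (1\<^sub>m m) K))"
proof -
  from assms(1) obtain N P Q where s: "\<And>k. k < N \<Longrightarrow> psd m (P k)" "\<And>k. k < N \<Longrightarrow> psd n (Q k)"
    and A: "A = mat_sum (m * n) (m * n) N (\<lambda>k. kron (P k) (Q k))" by (rule separable_coneE) blast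
  have c: "\<And>k. k < N \<Longrightarrow> P k \<in> carrier_mat m m" "\<And>k. k < N \<Longrightarrow> Q k \<in> carrier_mat n n"
    using s psd_carrier by auto
  define L where "L = kron (1\<^sub>m m) K"
  have L: "L \<in> carrier_mat (m * p) (m * n)" using K by (simp add: L_def)
  have L': "mat_adjoint L = kron (1\<^sub>m m) (mat_adjoint K)"
    unfolding L_def by (simp add: mat_adjoint_kron[OF one_carrier_mat K] mat_adjoint_one)
  have K': "mat_adjoint K \<in> carrier_mat n p" using K by simp
  have "L * A * mat_adjoint L = mat_sum (m * p) (m * p) N (\<lambda>k. L * kron (P k) (Q k) * mat_adjoint L)"
    unfolding A using L c by (simp add: mult_mat_sum[OF L] mat_sum_mult[OF mat_adjoint_carrier[OF L]] mult_carrier_mat[OF L])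
  also have "\<dots> = mat_sum (m * p) (m * p) N (\<lambda>k. kron (P k) (K * Q k * mat_adjoint K))"
  proof (rule mat_sum_cong)
    fix k assume k: "k < N"
    have PC: "1\<^sub>m m * P k \<in> carrier_mat m m" and QC: "K * Q k \<in> carrier_mat p n"
      using c(1)[OF k] c(2)[OF k] K by simp_all
    have "L * kron (P k) (Q k) * mat_adjoint L = kron (1\<^sub>m m * P k) (K * Q k) * kron (1\<^sub>m m) (mat_adjoint K)"
      unfolding L' unfolding L_def by (simp only: kron_mult[OF one_carrier_mat K c(1)[OF k] c(2)[OF k]])
    also have "\<dots> = kron (1\<^sub>m m * P k * 1\<^sub>m m) (K * Q k * mat_adjoint K)"
      by (rule kron_mult[OF PC QC one_carrier_mat K'])
    finally show "L * kron (P k) (Q k) * mat_adjoint L = kron (P k) (K * Q k * mat_adjoint K)"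
      using c(1)[OF k] by simp
  qed
  finally have *: "L * A * mat_adjoint L = \<dots>" .
  show ?thesis unfolding L_def[symmetric] * by (rule separable_coneI) (use s psd_congruence K in blast)
qed

lemma separable_cone_ptrace2:
  assumes "separable_cone m (n * b) A"
  shows "separable_cone m n (ptrace2 (m * n) b A)"
proof -
  from assms(1) obtain N P Q where s: "\<And>k. k < N \<Longrightarrow> psd m (P k)" "\<And>k. k < N \<Longrightarrow> psd (n * b) (Q k)"
    and A: "A = mat_sum (m * (n * b)) (m * (n * b)) N (\<lambda>k. kron (P k) (Q k))" by (rule separable_coneE) blast
  have "ptrace2 (m * n) b A = mat_sum (m * n) (m * n) N (\<lambda>k. ptrace2 (m * n) b (kron (P k) (Q k)))"
    unfolding A using ptrace2_mat_sum[of "m * n" b] by (simp only: mult.assoc)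
  also have "\<dots> = mat_sum (m * n) (m * n) N (\<lambda>k. kron (P k) (ptrace2 n b (Q k)))"
    by (rule mat_sum_cong) (rule ptrace2_kron[OF psd_carrier[OF s(1)] psd_carrier[OF s(2)]])
  finally have *: "ptrace2 (m * n) b A = \<dots>" .
  show ?thesis unfolding * by (rule separable_coneI) (use s psd_ptrace2 in blast)
qed

lemma separable_cone_trace_nonneg:
  assumes "separable_cone m n A"
  shows "0 \<le> mat_trace A"
proof -
  from assms(1) obtain N P Q where s: "\<And>k. k < N \<Longrightarrow> psd m (P k)" "\<And>k. k < N \<Longrightarrow> psd n (Q k)"
    and A: "A = mat_sum (m * n) (m * n) N (\<lambda>k. kron (P k) (Q k))" by (rule separable_coneE) blast
  have "mat_trace A = (\<Sum>k<N. 1 * (mat_trace (P k) * mat_trace (Q k)))"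
    using mat_trace_sum_kron[of N P m Q n "\<lambda>_. 1"] s psd_carrier unfolding A mat_sum_def by simp
  also have "0 \<le> \<dots>"
    using psd_trace_nonneg[OF s(1)] psd_trace_nonneg[OF s(2)]
    by (intro sum_nonneg) (simp add: less_eq_complex_def)
  finally show ?thesis .
qed

lemma separable_cone_smult:
  assumes "separable_cone m n A" "0 \<le> c"
  shows "separable_cone m n (c \<cdot>\<^sub>m A)"
proof -
  from assms(1) obtain N P Q where s: "\<And>k. k < N \<Longrightarrow> psd m (P k)" "\<And>k. k < N \<Longrightarrow> psd n (Q k)"
    and A: "A = mat_sum (m * n) (m * n) N (\<lambda>k. kron (P k) (Q k))" by (rule separable_coneE) blast
  have d: "dim_row (kron (P k) (Q k)) = m * n" "dim_col (kron (P k) (Q k)) = m * n" if "k < N" for k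
    using psd_carrier[OF s(1)[OF that]] psd_carrier[OF s(2)[OF that]] by (auto simp: kron_def)
  have "c \<cdot>\<^sub>m A = mat_sum (m * n) (m * n) N (\<lambda>k. kron (c \<cdot>\<^sub>m P k) (Q k))"
    unfolding A by (rule eq_matI) (auto simp: mat_sum_def kron_smult_left sum_distrib_left d)
  then show ?thesis using separable_coneI[of N m "\<lambda>k. c \<cdot>\<^sub>m P k" n Q] s psd_smult[OF _ assms(2)] by simp
qed

subsection \<open>The transfer operator\<close>

lemma kron_one_left_entry:
  assumes B: "B \<in> carrier_mat p q" and *: "i < n" "k < p" "j < n" "l < q"
  shows "kron (1\<^sub>m n) B $$ (i * p + k, j * q + l) = (if i = j then B $$ (k, l) else 0)"
  using kron_entry[OF one_carrier_mat B *] * by simp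

text \<open>Each entry is a linear form in the entries of \<open>B\<close>, with partial Gram sums
  of the rows of \<open>P\<close> as coefficients. Linearity of the transfer operator, its matrix,
  the uniform bound and the operators \<open>G\<close> of the recovery are all read off from this
  formula.\<close>

lemma kron_one_conjugation_entry:
  assumes P: "P \<in> carrier_mat p (q * b)" and B: "B \<in> carrier_mat b b" and ij: "i < p" "j < p"
  shows "(P * kron (1\<^sub>m q) B * mat_adjoint P) $$ (i, j)
    = (\<Sum>k<b. \<Sum>l<b. (\<Sum>s<q. P $$ (i, s * b + k) * cnj (P $$ (j, s * b + l))) * B $$ (k, l))"
proof -
  have K: "kron (1\<^sub>m q) B \<in> carrier_mat (q * b) (q * b)" using B by simp
  have PK: "P * kron (1\<^sub>m q) B \<in> carrier_mat p (q * b)" using P K by simp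
  have 1: "(P * kron (1\<^sub>m q) B) $$ (i, s * b + l) = (\<Sum>k<b. P $$ (i, s * b + k) * B $$ (k, l))"
    if sl: "s < q" "l < b" for s l
  proof -
    have "(P * kron (1\<^sub>m q) B) $$ (i, s * b + l)
        = (\<Sum>t<q. \<Sum>k<b. P $$ (i, t * b + k) * kron (1\<^sub>m q) B $$ (t * b + k, s * b + l))"
      by (simp only: mult_mat_entry[OF P K ij(1) pair_index_less[OF sl]] sum_pair_index)
    also have "\<dots> = (\<Sum>t<q. \<Sum>k<b. P $$ (i, t * b + k) * (if t = s then B $$ (k, l) else 0))"
      using sl by (intro sum.cong refl) (simp add: kron_one_left_entry[OF B])
    also have "\<dots> = (\<Sum>k<b. P $$ (i, s * b + k) * B $$ (k, l))"
      using sl(1) by (subst sum_eq_single[of s]) auto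
    finally show ?thesis .
  qed
  have "(P * kron (1\<^sub>m q) B * mat_adjoint P) $$ (i, j)
      = (\<Sum>s<q. \<Sum>l<b. (P * kron (1\<^sub>m q) B) $$ (i, s * b + l) * mat_adjoint P $$ (s * b + l, j))"
    by (simp only: mult_mat_entry[OF PK mat_adjoint_carrier[OF P] ij] sum_pair_index)
  also have "\<dots> = (\<Sum>s<q. \<Sum>l<b. \<Sum>k<b. P $$ (i, s * b + k) * cnj (P $$ (j, s * b + l)) * B $$ (k, l))"
  proof (intro sum.cong refl)
    fix s l assume "s \<in> {..<q}" "l \<in> {..<b}"
    then have sl: "s < q" "l < b" by auto
    show "(P * kron (1\<^sub>m q) B) $$ (i, s * b + l) * mat_adjoint P $$ (s * b + l, j)
        = (\<Sum>k<b. P $$ (i, s * b + k) * cnj (P $$ (j, s * b + l)) * B $$ (k, l))"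
      unfolding 1[OF sl] mat_adjoint_entry[OF P pair_index_less[OF sl] ij(2)]
      by (simp add: sum_distrib_right sum_distrib_left mult_ac)
  qed
  also have "\<dots> = (\<Sum>k<b. \<Sum>s<q. \<Sum>l<b. P $$ (i, s * b + k) * cnj (P $$ (j, s * b + l)) * B $$ (k, l))"
    by (rule sum_swap3)
  also have "\<dots> = (\<Sum>k<b. \<Sum>l<b. \<Sum>s<q. P $$ (i, s * b + k) * cnj (P $$ (j, s * b + l)) * B $$ (k, l))"
    by (intro sum.cong refl sum.swap)
  finally show ?thesis by (simp add: sum_distrib_right)
qed

text \<open>The rows of a coisometry are unit vectors, so by
  \<open>2 * x * y \<le> x^2 + y^2\<close> each Gram coefficient has modulus at most 1. The bound is
  independent of \<open>q\<close>, hence uniform in the number of spins.\<close>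

lemma kron_one_conjugation_bound:
  assumes P: "P \<in> carrier_mat p (q * b)" and iso: "P * mat_adjoint P = 1\<^sub>m p"
    and B: "B \<in> carrier_mat b b" and ij: "i < p" "j < p"
  shows "cmod ((P * kron (1\<^sub>m q) B * mat_adjoint P) $$ (i, j)) \<le> (\<Sum>k<b. \<Sum>l<b. cmod (B $$ (k, l)))"
proof -
  have row: "(\<Sum>s<q. \<Sum>k<b. (cmod (P $$ (x, s * b + k)))\<^sup>2) = 1" if x: "x < p" for x
  proof -
    have "1 = (P * mat_adjoint P) $$ (x, x)" using iso x by simp
    also have "\<dots> = (\<Sum>s<q. \<Sum>k<b. P $$ (x, s * b + k) * mat_adjoint P $$ (s * b + k, x))"
      by (simp only: mult_mat_entry[OF P mat_adjoint_carrier[OF P] x x] sum_pair_index)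
    also have "\<dots> = (\<Sum>s<q. \<Sum>k<b. of_real ((cmod (P $$ (x, s * b + k)))\<^sup>2))"
      unfolding complex_norm_square using x
      by (intro sum.cong refl) (simp add: mat_adjoint_entry[OF P] pair_index_less)
    also have "\<dots> = of_real (\<Sum>s<q. \<Sum>k<b. (cmod (P $$ (x, s * b + k)))\<^sup>2)" by simp
    finally have "complex_of_real (\<Sum>s<q. \<Sum>k<b. (cmod (P $$ (x, s * b + k)))\<^sup>2) = complex_of_real 1"
      unfolding of_real_1 by (rule sym)
    then show ?thesis by (simp only: of_real_eq_iff)
  qed
  have part: "(\<Sum>s<q. (cmod (P $$ (x, s * b + k)))\<^sup>2) \<le> 1" if "x < p" "k < b" for x k
  proof -
    have "(\<Sum>s<q. (cmod (P $$ (x, s * b + k)))\<^sup>2) \<le> (\<Sum>s<q. \<Sum>k<b. (cmod (P $$ (x, s * b + k)))\<^sup>2)"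
    proof (rule sum_mono)
      fix s
      show "(cmod (P $$ (x, s * b + k)))\<^sup>2 \<le> (\<Sum>k<b. (cmod (P $$ (x, s * b + k)))\<^sup>2)"
        by (rule member_le_sum) (use that(2) in auto)
    qed
    then show ?thesis unfolding row[OF that(1)] .
  qed
  have coeff: "cmod (\<Sum>s<q. P $$ (i, s * b + k) * cnj (P $$ (j, s * b + l))) \<le> 1" if "k < b" "l < b" for k l
  proof -
    have "2 * cmod (\<Sum>s<q. P $$ (i, s * b + k) * cnj (P $$ (j, s * b + l)))
        \<le> 2 * (\<Sum>s<q. cmod (P $$ (i, s * b + k)) * cmod (P $$ (j, s * b + l)))"
      using norm_sum[of "\<lambda>s. P $$ (i, s * b + k) * cnj (P $$ (j, s * b + l))" "{..<q}"] by (simp add: norm_mult)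
    also have "\<dots> \<le> (\<Sum>s<q. (cmod (P $$ (i, s * b + k)))\<^sup>2 + (cmod (P $$ (j, s * b + l)))\<^sup>2)"
      unfolding sum_distrib_left using sum_squares_bound by (intro sum_mono) (simp add: mult.assoc)
    also have "\<dots> \<le> 1 + 1" unfolding sum.distrib by (intro add_mono part ij that)
    finally show ?thesis by simp
  qed
  let ?c = "\<lambda>k l. \<Sum>s<q. P $$ (i, s * b + k) * cnj (P $$ (j, s * b + l))"
  have "cmod ((P * kron (1\<^sub>m q) B * mat_adjoint P) $$ (i, j))
      \<le> (\<Sum>k<b. cmod (\<Sum>l<b. ?c k l * B $$ (k, l)))"
    unfolding kron_one_conjugation_entry[OF P B ij] by (rule norm_sum)
  also have "\<dots> \<le> (\<Sum>k<b. \<Sum>l<b. cmod (?c k l * B $$ (k, l)))"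
    by (rule sum_mono) (rule norm_sum)
  also have "\<dots> \<le> (\<Sum>k<b. \<Sum>l<b. cmod (B $$ (k, l)))"
    using coeff by (intro sum_mono) (simp add: norm_mult mult_left_le_one_le)
  finally show ?thesis .
qed

primrec fcs_W :: "nat \<Rightarrow> nat \<Rightarrow> complex mat \<Rightarrow> nat \<Rightarrow> complex mat" where
  "fcs_W d b V 0 = 1\<^sub>m b"
| "fcs_W d b V (Suc m) = fcs_W d b V m * kron (1\<^sub>m (d ^ m)) V"

lemma kron_one_V_carrier:
  "V \<in> carrier_mat b (d * b) \<Longrightarrow> kron (1\<^sub>m (d ^ m)) V \<in> carrier_mat (d ^ m * b) (d ^ Suc m * b)"
  using kron_carrier[OF one_carrier_mat[of "d ^ m"], of V b "d * b"] by (simp add: mult_ac)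

lemma fcs_W_carrier:
  assumes V: "V \<in> carrier_mat b (d * b)"
  shows "fcs_W d b V m \<in> carrier_mat b (d ^ m * b)"
proof (induction m)
  case (Suc m)
  then show ?case unfolding fcs_W.simps by (rule mult_carrier_mat[OF _ kron_one_V_carrier[OF V]])
qed simp

lemma fcs_Ehat_carrier:
  assumes "V \<in> carrier_mat b (d * b)" "B \<in> carrier_mat b b"
  shows "fcs_Ehat d V B \<in> carrier_mat b b"
  unfolding fcs_Ehat_def fcs_E_def
  by (intro mult_carrier_mat[of _ _ "d * b"] mat_adjoint_carrier kron_carrier one_carrier_mat assms)

lemma fcs_Ehat_power_carrier:
  assumes "V \<in> carrier_mat b (d * b)" "B \<in> carrier_mat b b"
  shows "(fcs_Ehat d V ^^ m) B \<in> carrier_mat b b"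
  using assms by (induction m) (auto intro: fcs_Ehat_carrier)

text \<open>The rightmost factor of \<open>fcs_W\<close> acts first: it absorbs the last spin and
  replaces \<open>B\<close> by its image under the transfer operator. Hence the induction hypothesis
  is needed for arbitrary \<open>B\<close>.\<close>

lemma fcs_W_conjugation:
  assumes V: "V \<in> carrier_mat b (d * b)" and B: "B \<in> carrier_mat b b"
  shows "fcs_W d b V m * kron (1\<^sub>m (d ^ m)) B * mat_adjoint (fcs_W d b V m) = (fcs_Ehat d V ^^ m) B"
  using B
proof (induction m arbitrary: B)
  case 0
  have "kron (1\<^sub>m 1) B = B"
    by (rule eq_mat_pairI[of _ 1 b 1 b]) (use 0 kron_one_left_entry[OF 0, of 0 1 _ 0] kron_carrier[OF one_carrier_mat 0, of 1] in auto)
  then show ?case using 0 by (simp add: mat_adjoint_one)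
next
  case (Suc m)
  let ?W = "fcs_W d b V m" and ?K = "kron (1\<^sub>m (d ^ m)) V"
  have W: "?W \<in> carrier_mat b (d ^ m * b)" by (rule fcs_W_carrier[OF V])
  have K: "?K \<in> carrier_mat (d ^ m * b) (d ^ Suc m * b)" by (rule kron_one_V_carrier[OF V])
  have W': "mat_adjoint ?W \<in> carrier_mat (d ^ m * b) b" and K': "mat_adjoint ?K \<in> carrier_mat (d ^ Suc m * b) (d ^ m * b)"
    using W K by (auto simp del: power_Suc)
  have V': "mat_adjoint V \<in> carrier_mat (d * b) b" using V by simp
  let ?X = "kron (1\<^sub>m (d ^ Suc m)) B"
  have X: "?X \<in> carrier_mat (d ^ Suc m * b) (d ^ Suc m * b)" using Suc.prems by simp
  \<comment> \<open>Splitting off the identity of the last spin exposes the argument of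
    \<open>fcs_Ehat\<close> under the first \<open>m\<close> spins.\<close>
  have X2: "?X = kron (1\<^sub>m (d ^ m)) (kron (1\<^sub>m d) B)"
    using kron_assoc[OF one_carrier_mat one_carrier_mat Suc.prems, of "d ^ m" d]
    by (simp add: kron_one_one mult.commute)
  have KX: "?K * ?X \<in> carrier_mat (d ^ m * b) (d ^ Suc m * b)" by (rule mult_carrier_mat[OF K X])
  have Bd: "kron (1\<^sub>m d) B \<in> carrier_mat (d * b) (d * b)" using Suc.prems by simp
  have inner: "?K * ?X * mat_adjoint ?K = kron (1\<^sub>m (d ^ m)) (fcs_Ehat d V B)"
    unfolding X2 mat_adjoint_kron[OF one_carrier_mat V] mat_adjoint_one fcs_Ehat_def fcs_E_def
    by (simp add: kron_mult[OF one_carrier_mat V one_carrier_mat Bd]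
        kron_mult[OF one_carrier_mat mult_carrier_mat[OF V Bd] one_carrier_mat V'])
  have "fcs_W d b V (Suc m) * ?X * mat_adjoint (fcs_W d b V (Suc m)) = ?W * (?K * ?X * mat_adjoint ?K) * mat_adjoint ?W"
    unfolding fcs_W.simps mat_adjoint_mult[OF W K]
    by (simp only: assoc_mult_mat[OF W K X] assoc_mult_mat[OF W KX K', symmetric]
        assoc_mult_mat[OF mult_carrier_mat[OF W KX] K' W', symmetric])
  also have "\<dots> = (fcs_Ehat d V ^^ Suc m) B"
    unfolding inner Suc.IH[OF fcs_Ehat_carrier[OF V Suc.prems]] by (simp add: funpow_swap1)
  finally show ?case .
qed

context pure_fcs
begin

lemma fcs_Ehat_entry:
  assumes "B \<in> carrier_mat b b" "i < b" "j < b"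
  shows "fcs_Ehat d V B $$ (i, j)
    = (\<Sum>k<b. \<Sum>l<b. (\<Sum>s<d. V $$ (i, s * b + k) * cnj (V $$ (j, s * b + l))) * B $$ (k, l))"
  unfolding fcs_Ehat_def fcs_E_def by (rule kron_one_conjugation_entry[OF V_carrier assms])

lemma fcs_Ehat_one: "fcs_Ehat d V (1\<^sub>m b) = 1\<^sub>m b"
  using V_coisometry V_carrier by (simp add: fcs_Ehat_def fcs_E_def kron_one_one)

lemma fcs_W_coisometry: "fcs_W d b V m * mat_adjoint (fcs_W d b V m) = 1\<^sub>m b"
proof -
  have "(fcs_Ehat d V ^^ m) (1\<^sub>m b) = 1\<^sub>m b" by (induction m) (simp_all add: fcs_Ehat_one)
  then show ?thesis
    using fcs_W_conjugation[OF V_carrier one_carrier_mat, of m] fcs_W_carrier[OF V_carrier, of m]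
    by (simp add: kron_one_one)
qed

text \<open>The iterates at \<open>B\<close> are conjugations of \<open>B\<close> by coisometries
  and thus bounded uniformly in \<open>m\<close>, while an eigenvalue of modulus above 1 would make
  \<open>z ^ m\<close> times a nonzero entry unbounded.\<close>

lemma fcs_Ehat_eigenvalue_le:
  assumes B: "B \<in> carrier_mat b b" "B \<noteq> 0\<^sub>m b b" and eig: "fcs_Ehat d V B = z \<cdot>\<^sub>m B"
  shows "cmod z \<le> 1"
proof (rule ccontr)
  assume z: "\<not> cmod z \<le> 1"
  obtain i j where ij: "i < b" "j < b" "B $$ (i, j) \<noteq> 0"
    using B by (metis eq_matI carrier_matD index_zero_mat)
  have Esm: "fcs_Ehat d V (c \<cdot>\<^sub>m B) = (c * z) \<cdot>\<^sub>m B" for c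
  proof (rule eq_matI)
    fix x y assume "x < dim_row ((c * z) \<cdot>\<^sub>m B)" "y < dim_col ((c * z) \<cdot>\<^sub>m B)"
    then have xy: "x < b" "y < b" using B by auto
    have "fcs_Ehat d V (c \<cdot>\<^sub>m B) $$ (x, y) = c * fcs_Ehat d V B $$ (x, y)"
      using B xy by (simp add: fcs_Ehat_entry sum_distrib_left mult_ac)
    then show "fcs_Ehat d V (c \<cdot>\<^sub>m B) $$ (x, y) = ((c * z) \<cdot>\<^sub>m B) $$ (x, y)"
      using B xy by (simp add: eig)
  qed (use fcs_Ehat_carrier[OF V_carrier smult_carrier_mat[OF B(1)], of c] B in auto)
  have pow: "(fcs_Ehat d V ^^ m) B = z ^ m \<cdot>\<^sub>m B" for m
    using B by (induction m) (auto simp: Esm mult_ac)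
  define c where "c = (\<Sum>k<b. \<Sum>l<b. cmod (B $$ (k, l)))"
  have "cmod z ^ m * cmod (B $$ (i, j)) \<le> c" for m
    using kron_one_conjugation_bound[OF fcs_W_carrier[OF V_carrier] fcs_W_coisometry B(1) ij(1,2), of m]
      B ij unfolding fcs_W_conjugation[OF V_carrier B(1)] pow c_def by (simp add: norm_mult norm_power)
  then have "cmod z ^ m \<le> c / cmod (B $$ (i, j))" for m using ij(3) by (simp add: field_simps)
  moreover obtain m where "c / cmod (B $$ (i, j)) < cmod z ^ m"
    using real_arch_pow[of "cmod z"] z by auto
  ultimately show False by (meson not_less)
qed

definition mean :: "complex mat \<Rightarrow> complex" where
  "mean B = mat_trace (\<rho> * B)"

lemma rho_carrier: "\<rho> \<in> carrier_mat b b"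
  using density by (simp add: density_matrix_def)

lemma mean_eq_sum:
  assumes "B \<in> carrier_mat b b"
  shows "mean B = (\<Sum>k<b. \<Sum>l<b. \<rho> $$ (l, k) * B $$ (k, l))"
proof -
  have "mean B = (\<Sum>l<b. \<Sum>k<b. \<rho> $$ (l, k) * B $$ (k, l))"
    unfolding mean_def mat_trace_def using rho_carrier
    by (auto simp: mult_mat_entry[OF rho_carrier assms] simp del: index_mult_mat(1) intro!: sum.cong)
  also have "\<dots> = (\<Sum>k<b. \<Sum>l<b. \<rho> $$ (l, k) * B $$ (k, l))" by (rule sum.swap)
  finally show ?thesis .
qed

lemma mean_Ehat: "B \<in> carrier_mat b b \<Longrightarrow> mean (fcs_Ehat d V B) = mean B"
  using invariant by (simp add: mean_def fcs_invariant_def)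

lemma mean_one: "mean (1\<^sub>m b) = 1"
  using density rho_carrier by (simp add: mean_def density_matrix_def)

text \<open>The projection onto the kernel of \<open>mean\<close> along the identity. It commutes
  with the transfer operator, because \<open>mean\<close> is invariant and the operator is
  unital.\<close>

definition fluctuation :: "complex mat \<Rightarrow> complex mat" where
  "fluctuation B = mat b b (\<lambda>(i, j). B $$ (i, j) - mean B * 1\<^sub>m b $$ (i, j))"

lemma fluctuation_carrier [simp]: "fluctuation B \<in> carrier_mat b b"
  by (simp add: fluctuation_def)

lemma mean_fluctuation:
  assumes "B \<in> carrier_mat b b"
  shows "mean (fluctuation B) = 0"
proof -
  have "mean (fluctuation B)
      = (\<Sum>k<b. \<Sum>l<b. \<rho> $$ (l, k) * B $$ (k, l) - mean B * (\<rho> $$ (l, k) * 1\<^sub>m b $$ (k, l)))"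
    unfolding mean_eq_sum[OF fluctuation_carrier]
    by (intro sum.cong refl) (simp add: fluctuation_def algebra_simps del: index_one_mat(1))
  also have "\<dots> = mean B - mean B * mean (1\<^sub>m b)"
    by (simp only: sum_subtractf sum_distrib_left[symmetric] mean_eq_sum[OF assms, symmetric]
        mean_eq_sum[OF one_carrier_mat, symmetric])
  finally have "mean (fluctuation B) = mean B - mean B * mean (1\<^sub>m b)" .
  then show ?thesis by (simp add: mean_one)
qed

lemma fcs_Ehat_fluctuation:
  assumes B: "B \<in> carrier_mat b b"
  shows "fcs_Ehat d V (fluctuation B) = fluctuation (fcs_Ehat d V B)"
proof (rule eq_matI)
  have c: "fcs_Ehat d V (fluctuation B) \<in> carrier_mat b b" by (intro fcs_Ehat_carrier V_carrier fluctuation_carrier)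
  show "dim_row (fcs_Ehat d V (fluctuation B)) = dim_row (fluctuation (fcs_Ehat d V B))"
    "dim_col (fcs_Ehat d V (fluctuation B)) = dim_col (fluctuation (fcs_Ehat d V B))"
    using carrier_matD[OF c] carrier_matD[OF fluctuation_carrier] by simp_all
  fix i j assume "i < dim_row (fluctuation (fcs_Ehat d V B))" "j < dim_col (fluctuation (fcs_Ehat d V B))"
  then have ij: "i < b" "j < b" using carrier_matD[OF fluctuation_carrier] by auto
  have "fcs_Ehat d V (fluctuation B) $$ (i, j) = fcs_Ehat d V B $$ (i, j) - mean B * fcs_Ehat d V (1\<^sub>m b) $$ (i, j)"
    unfolding fcs_Ehat_entry[OF fluctuation_carrier ij] fcs_Ehat_entry[OF B ij] fcs_Ehat_entry[OF one_carrier_mat ij]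
    by (simp add: fluctuation_def algebra_simps sum_subtractf sum_distrib_left del: index_one_mat(1))
  also have "\<dots> = fluctuation (fcs_Ehat d V B) $$ (i, j)"
    using ij unfolding fcs_Ehat_one by (simp add: fluctuation_def mean_Ehat[OF B])
  finally show "fcs_Ehat d V (fluctuation B) $$ (i, j) = fluctuation (fcs_Ehat d V B) $$ (i, j)" .
qed

definition vectorise :: "complex mat \<Rightarrow> complex vec" where
  "vectorise B = vec (b * b) (\<lambda>p. B $$ (p div b, p mod b))"

text \<open>The matrix of \<open>B \<mapsto> E(B) - Tr(\<rho> B) 1\<close>, where \<open>E\<close> is the transfer operator. Subtracting the
  projection onto the multiples of the identity removes the eigenvalue \<open>1\<close>, so that the peripheral
  spectrum condition makes the spectral radius smaller than \<open>1\<close>.\<close>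

definition transfer_matrix :: "complex mat" where
  "transfer_matrix = mat (b * b) (b * b) (\<lambda>(p, q).
     (\<Sum>s<d. V $$ (p div b, s * b + q div b) * cnj (V $$ (p mod b, s * b + q mod b)))
     - \<rho> $$ (q mod b, q div b) * 1\<^sub>m b $$ (p div b, p mod b))"

lemma transfer_matrix_carrier: "transfer_matrix \<in> carrier_mat (b * b) (b * b)"
  by (simp add: transfer_matrix_def)

lemma vectorise_carrier: "vectorise B \<in> carrier_vec (b * b)"
  by (simp add: vectorise_def)

lemma transfer_matrix_mult:
  assumes B: "B \<in> carrier_mat b b"
  shows "transfer_matrix *\<^sub>v vectorise B = vectorise (fluctuation (fcs_Ehat d V B))"
proof (rule eq_vecI)
  show "dim_vec (transfer_matrix *\<^sub>v vectorise B) = dim_vec (vectorise (fluctuation (fcs_Ehat d V B)))"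
    by (simp add: transfer_matrix_def vectorise_def)
  fix p assume "p < dim_vec (vectorise (fluctuation (fcs_Ehat d V B)))"
  then have p: "p < b * b" by (simp add: vectorise_def)
  then obtain i j where ij: "i < b" "j < b" "p = i * b + j" by (rule pair_index_cases)
  have "(transfer_matrix *\<^sub>v vectorise B) $ p = (\<Sum>k<b. \<Sum>l<b.
     transfer_matrix $$ (p, k * b + l) * vectorise B $ (k * b + l))"
    by (simp only: mult_mat_vec_entry[OF transfer_matrix_carrier vectorise_carrier p] sum_pair_index)
  also have "\<dots> = (\<Sum>k<b. \<Sum>l<b. ((\<Sum>s<d. V $$ (i, s * b + k) * cnj (V $$ (j, s * b + l)))
     - \<rho> $$ (l, k) * 1\<^sub>m b $$ (i, j)) * B $$ (k, l))"
    using ij by (intro sum.cong refl)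
      (simp add: transfer_matrix_def vectorise_def pair_index_less del: index_one_mat(1))
  also have "\<dots> = fcs_Ehat d V B $$ (i, j) - mean B * 1\<^sub>m b $$ (i, j)"
    unfolding fcs_Ehat_entry[OF B ij(1,2)] mean_eq_sum[OF B]
    by (simp add: algebra_simps sum_subtractf sum_distrib_left del: index_one_mat(1))
  also have "\<dots> = vectorise (fluctuation (fcs_Ehat d V B)) $ p"
    using ij p by (simp add: vectorise_def fluctuation_def mean_Ehat[OF B])
  finally show "(transfer_matrix *\<^sub>v vectorise B) $ p = vectorise (fluctuation (fcs_Ehat d V B)) $ p" .
qed

text \<open>Every value of the map has mean zero, so for \<open>z \<noteq> 0\<close> the eigenvector
  has mean zero too and is an eigenvector of the transfer operator itself. Modulus 1 would make it a
  multiple of the identity, and mean zero would then make it vanish.\<close>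

lemma transfer_matrix_eigenvalue:
  assumes "eigenvalue transfer_matrix z"
  shows "cmod z < 1"
proof -
  obtain v where v: "v \<in> carrier_vec (b * b)" "v \<noteq> 0\<^sub>v (b * b)" "transfer_matrix *\<^sub>v v = z \<cdot>\<^sub>v v"
    using assms by (auto simp: eigenvalue_def eigenvector_def transfer_matrix_def)
  define B where "B = mat b b (\<lambda>(i, j). v $ (i * b + j))"
  have B: "B \<in> carrier_mat b b" by (simp add: B_def)
  have vB: "v = vectorise B"
  proof (rule eq_vecI)
    fix p assume "p < dim_vec (vectorise B)"
    then have "p < b * b" by (simp add: vectorise_def)
    then show "v $ p = vectorise B $ p"
      using b_pos by (simp add: vectorise_def B_def less_mult_imp_div_less)
  qed (use v in \<open>simp add: vectorise_def\<close>)
  have B0: "B \<noteq> 0\<^sub>m b b"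
  proof
    assume z: "B = 0\<^sub>m b b"
    have "v = 0\<^sub>v (b * b)"
      unfolding vB z by (rule eq_vecI) (use b_pos in \<open>auto simp: vectorise_def less_mult_imp_div_less\<close>)
    then show False using v(2) by simp
  qed
  have eig: "fluctuation (fcs_Ehat d V B) = z \<cdot>\<^sub>m B"
  proof (rule eq_matI)
    fix i j assume "i < dim_row (z \<cdot>\<^sub>m B)" "j < dim_col (z \<cdot>\<^sub>m B)"
    then have ij: "i < b" "j < b" using B by auto
    have "vectorise (fluctuation (fcs_Ehat d V B)) $ (i * b + j) = (z \<cdot>\<^sub>v vectorise B) $ (i * b + j)"
      using v(3) unfolding vB transfer_matrix_mult[OF B] by simp
    then show "fluctuation (fcs_Ehat d V B) $$ (i, j) = (z \<cdot>\<^sub>m B) $$ (i, j)"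
      using ij B by (simp add: vectorise_def pair_index_less)
  qed (use B carrier_matD[OF fluctuation_carrier] in auto)
  have E: "fcs_Ehat d V B \<in> carrier_mat b b" by (rule fcs_Ehat_carrier[OF V_carrier B])
  have "mean (z \<cdot>\<^sub>m B) = 0" unfolding eig[symmetric] by (rule mean_fluctuation[OF E])
  moreover have "mean (z \<cdot>\<^sub>m B) = z * mean B"
    using B by (simp add: mean_eq_sum sum_distrib_left mult_ac)
  ultimately have "z = 0 \<or> mean B = 0" by simp
  then show ?thesis
  proof
    assume mB: "mean B = 0"
    have eig': "fcs_Ehat d V B = z \<cdot>\<^sub>m B"
      unfolding eig[symmetric] using E carrier_matD[OF fluctuation_carrier]
      by (intro eq_matI) (auto simp: fluctuation_def mean_Ehat[OF B] mB)
    have "cmod z \<noteq> 1"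
    proof
      assume "cmod z = 1"
      then obtain c where c: "B = c \<cdot>\<^sub>m 1\<^sub>m b" using peripheral[OF B B0 _ eig'] by blast
      have "mean B = c * mean (1\<^sub>m b)"
        unfolding c by (simp add: mean_eq_sum sum_distrib_left mult_ac del: index_one_mat(1))
      then have "c = 0" using mB mean_one by simp
      then have "B = 0\<^sub>m b b" unfolding c by (intro eq_matI) auto
      then show False using B0 by simp
    qed
    then show ?thesis using fcs_Ehat_eigenvalue_le[OF B B0 eig'] by simp
  qed simp
qed

lemma fcs_Ehat_power_tendsto:
  assumes B: "B \<in> carrier_mat b b" and ij: "i < b" "j < b"
  shows "(\<lambda>m. (fcs_Ehat d V ^^ m) B $$ (i, j)) \<longlonglongrightarrow> mean B * 1\<^sub>m b $$ (i, j)"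
proof -
  have E: "(fcs_Ehat d V ^^ m) B \<in> carrier_mat b b" for m by (rule fcs_Ehat_power_carrier[OF V_carrier B])
  have mean: "mean ((fcs_Ehat d V ^^ m) B) = mean B" for m
    by (induction m) (simp_all add: mean_Ehat[OF E])
  define x where "x m = vectorise (fluctuation ((fcs_Ehat d V ^^ m) B))" for m
  \<comment> \<open>\<open>transfer_matrix\<close> projects after every application and the orbit
    consists of projected matrices; idempotence merges the two projections.\<close>
  have idem: "fluctuation (fluctuation A) = fluctuation A" if "A \<in> carrier_mat b b" for A
    using mean_fluctuation[OF that] by (intro eq_matI) (auto simp: fluctuation_def[of "fluctuation A"] carrier_matD[OF fluctuation_carrier[of A]])
  have "(\<lambda>m. x m $ (i * b + j)) \<longlonglongrightarrow> 0"
  proof (rule orbit_tendsto_zero[OF transfer_matrix_carrier transfer_matrix_eigenvalue])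
    show "x m \<in> carrier_vec (b * b)" for m by (simp add: x_def vectorise_carrier)
    show "transfer_matrix *\<^sub>v x m = x (Suc m)" for m
      unfolding x_def transfer_matrix_mult[OF fluctuation_carrier] fcs_Ehat_fluctuation[OF E]
      using idem[OF E[of "Suc m"]] by simp
    show "i * b + j < b * b" using ij by (rule pair_index_less)
  qed
  moreover have "x m $ (i * b + j) = (fcs_Ehat d V ^^ m) B $$ (i, j) - mean B * 1\<^sub>m b $$ (i, j)" for m
    using ij by (simp add: x_def vectorise_def pair_index_less fluctuation_def mean)
  ultimately have "(\<lambda>m. ((fcs_Ehat d V ^^ m) B $$ (i, j) - mean B * 1\<^sub>m b $$ (i, j)) + mean B * 1\<^sub>m b $$ (i, j))
      \<longlonglongrightarrow> 0 + mean B * 1\<^sub>m b $$ (i, j)" by (intro tendsto_intros) simp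
  then show ?thesis by simp
qed

end

subsection \<open>Recovering the memory from the chain\<close>

text \<open>\<open>G k j\<close> is \<open>P (1 \<otimes> |k\<rangle>\<langle>j|) P\<^sup>*\<close>; expanding the partial trace over \<open>j\<close> and \<open>R\<close> in matrix units
  leaves only such operators acting on \<open>X\<close> from both sides.\<close>

lemma recovery_entry:
  assumes P: "P \<in> carrier_mat p (q * b)" and X: "X \<in> carrier_mat p p" and R: "R \<in> carrier_mat b b"
    and xy: "x < p" "y < p"
    and G: "\<And>k j x z. G k j x z = (\<Sum>s<q. P $$ (x, s * b + k) * cnj (P $$ (z, s * b + j)))"
  shows "(P * kron (ptrace2 q b (mat_adjoint P * X * P)) R * mat_adjoint P) $$ (x, y)
    = (\<Sum>k<b. \<Sum>l<b. \<Sum>j<b. \<Sum>z<p. \<Sum>z'<p. R $$ (k, l) * G k j x z * X $$ (z, z') * G j l z' y)"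
proof -
  have P': "mat_adjoint P \<in> carrier_mat (q * b) p" using P by simp
  have PX: "mat_adjoint P * X \<in> carrier_mat (q * b) p" using P' X by simp
  define Y where "Y = ptrace2 q b (mat_adjoint P * X * P)"
  have Y: "Y \<in> carrier_mat q q" by (simp add: Y_def)
  have K: "kron Y R \<in> carrier_mat (q * b) (q * b)" using Y R by simp
  have PK: "P * kron Y R \<in> carrier_mat p (q * b)" using P K by simp
  have Yst: "Y $$ (s, t) = (\<Sum>j<b. \<Sum>z<p. \<Sum>z'<p. cnj (P $$ (z, s * b + j)) * X $$ (z, z') * P $$ (z', t * b + j))"
    if st: "s < q" "t < q" for s t
  proof -
    have "Y $$ (s, t) = (\<Sum>j<b. (mat_adjoint P * X * P) $$ (s * b + j, t * b + j))"
      using st by (simp add: Y_def ptrace2_def)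
    also have "\<dots> = (\<Sum>j<b. \<Sum>z'<p. \<Sum>z<p. cnj (P $$ (z, s * b + j)) * X $$ (z, z') * P $$ (z', t * b + j))"
    proof (intro sum.cong refl)
      fix j assume "j \<in> {..<b}"
      then have sj: "s * b + j < q * b" and tj: "t * b + j < q * b" using st by (simp_all add: pair_index_less)
      have "(mat_adjoint P * X) $$ (s * b + j, z') = (\<Sum>z<p. cnj (P $$ (z, s * b + j)) * X $$ (z, z'))" if "z' < p" for z'
        unfolding mult_mat_entry[OF P' X sj that]
        by (intro sum.cong refl) (simp add: mat_adjoint_entry[OF P sj])
      then show "(mat_adjoint P * X * P) $$ (s * b + j, t * b + j)
          = (\<Sum>z'<p. \<Sum>z<p. cnj (P $$ (z, s * b + j)) * X $$ (z, z') * P $$ (z', t * b + j))"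
        unfolding mult_mat_entry[OF PX P sj tj] by (simp add: sum_distrib_right)
    qed
    also have "\<dots> = (\<Sum>j<b. \<Sum>z<p. \<Sum>z'<p. cnj (P $$ (z, s * b + j)) * X $$ (z, z') * P $$ (z', t * b + j))"
      by (intro sum.cong refl sum.swap)
    finally show ?thesis .
  qed
  have "(P * kron Y R * mat_adjoint P) $$ (x, y)
      = (\<Sum>t<q. \<Sum>l<b. \<Sum>s<q. \<Sum>k<b. P $$ (x, s * b + k) * (Y $$ (s, t) * R $$ (k, l)) * cnj (P $$ (y, t * b + l)))"
  proof -
    have "(P * kron Y R * mat_adjoint P) $$ (x, y)
      = (\<Sum>t<q. \<Sum>l<b. (P * kron Y R) $$ (x, t * b + l) * mat_adjoint P $$ (t * b + l, y))"
      by (simp only: mult_mat_entry[OF PK P' xy] sum_pair_index)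
    also have "\<dots> = (\<Sum>t<q. \<Sum>l<b. \<Sum>s<q. \<Sum>k<b. P $$ (x, s * b + k) * (Y $$ (s, t) * R $$ (k, l)) * cnj (P $$ (y, t * b + l)))"
    proof (intro sum.cong refl)
      fix t l assume "t \<in> {..<q}" "l \<in> {..<b}"
      then have t: "t < q" and l: "l < b" by auto
      have tl: "t * b + l < q * b" using t l by (rule pair_index_less)
      have "(P * kron Y R) $$ (x, t * b + l) = (\<Sum>s<q. \<Sum>k<b. P $$ (x, s * b + k) * (Y $$ (s, t) * R $$ (k, l)))"
        unfolding mult_mat_entry[OF P K xy(1) tl] sum_pair_index
        by (intro sum.cong refl) (simp add: kron_entry[OF Y R _ _ t l])
      then show "(P * kron Y R) $$ (x, t * b + l) * mat_adjoint P $$ (t * b + l, y)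
        = (\<Sum>s<q. \<Sum>k<b. P $$ (x, s * b + k) * (Y $$ (s, t) * R $$ (k, l)) * cnj (P $$ (y, t * b + l)))"
        by (simp add: mat_adjoint_entry[OF P tl xy(2)] sum_distrib_right)
    qed
    finally show ?thesis .
  qed
  also have "\<dots> = (\<Sum>t<q. \<Sum>l<b. \<Sum>s<q. \<Sum>k<b. \<Sum>j<b. \<Sum>z<p. \<Sum>z'<p.
      P $$ (x, s * b + k) * (cnj (P $$ (z, s * b + j)) * X $$ (z, z') * P $$ (z', t * b + j) * R $$ (k, l)) * cnj (P $$ (y, t * b + l)))"
    by (intro sum.cong refl) (simp add: Yst sum_distrib_left sum_distrib_right)
  \<comment> \<open>Flattening to one sum over tuples lets a single bijection reorder all seven
    indices. The spin indices \<open>s\<close> and \<open>t\<close> move innermost, where they form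
    the two factors \<open>G\<close>.\<close>
  also have "\<dots> = (\<Sum>(t, l, s, k, j, z, z')\<in>{..<q} \<times> {..<b} \<times> {..<q} \<times> {..<b} \<times> {..<b} \<times> {..<p} \<times> {..<p}.
      P $$ (x, s * b + k) * (cnj (P $$ (z, s * b + j)) * X $$ (z, z') * P $$ (z', t * b + j) * R $$ (k, l)) * cnj (P $$ (y, t * b + l)))"
    by (simp only: sum.cartesian_product split_beta fst_conv snd_conv)
  also have "\<dots> = (\<Sum>(k, l, j, z, z', t, s)\<in>{..<b} \<times> {..<b} \<times> {..<b} \<times> {..<p} \<times> {..<p} \<times> {..<q} \<times> {..<q}.
      R $$ (k, l) * (P $$ (x, s * b + k) * cnj (P $$ (z, s * b + j))) * X $$ (z, z') * (P $$ (z', t * b + j) * cnj (P $$ (y, t * b + l))))"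
    by (rule sum.reindex_bij_witness[where
          i = "\<lambda>(k, l, j, z, z', t, s). (t, l, s, k, j, z, z')" and
          j = "\<lambda>(t, l, s, k, j, z, z'). (k, l, j, z, z', t, s)"]) (auto simp: mult_ac)
  also have "\<dots> = (\<Sum>k<b. \<Sum>l<b. \<Sum>j<b. \<Sum>z<p. \<Sum>z'<p. \<Sum>t<q. \<Sum>s<q.
      R $$ (k, l) * (P $$ (x, s * b + k) * cnj (P $$ (z, s * b + j))) * X $$ (z, z') * (P $$ (z', t * b + j) * cnj (P $$ (y, t * b + l))))"
    by (simp only: sum.cartesian_product split_beta fst_conv snd_conv)
  also have "\<dots> = (\<Sum>k<b. \<Sum>l<b. \<Sum>j<b. \<Sum>z<p. \<Sum>z'<p. R $$ (k, l) * G k j x z * X $$ (z, z') * G j l z' y)"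
    unfolding G by (intro sum.cong refl) (simp add: sum_distrib_left sum_distrib_right)
  finally show ?thesis unfolding Y_def .
qed

section \<open>The chain states as a local channel applied to the memory\<close>

text \<open>Every factor has \<open>k \<ge> 1\<close> and so leaves the first spin alone, which
  allows one factor \<open>1\<^sub>m d\<close> to be pulled out. A chain of \<open>Suc m\<close>
  spins thus corresponds to \<open>m\<close> steps of \<open>fcs_W\<close>.\<close>

lemma fcs_V_Suc:
  assumes V: "V \<in> carrier_mat b (d * b)"
  shows "fcs_V d b V (Suc m) = kron (1\<^sub>m d) (fcs_W d b V m)"
proof -
  \<comment> \<open>The start value is generalised because extending the list at its end pushes the
    new factor into the start value of \<open>foldr\<close>.\<close>
  have fold: "foldr (\<lambda>k M. kron (1\<^sub>m (d ^ k)) V * M) [1..<Suc m] Y = kron (1\<^sub>m d) (fcs_W d b V m) * Y"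
    if "Y \<in> carrier_mat (d ^ Suc m * b) r" for Y r
    using that
  proof (induction m arbitrary: Y)
    case 0
    then show ?case by (simp add: kron_one_one)
  next
    case (Suc m)
    let ?F = "kron (1\<^sub>m (d ^ Suc m)) V"
    have F: "?F \<in> carrier_mat (d ^ Suc m * b) (d ^ Suc (Suc m) * b)" by (rule kron_one_V_carrier[OF V])
    have W: "fcs_W d b V m \<in> carrier_mat b (d ^ m * b)" by (rule fcs_W_carrier[OF V])
    have K: "kron (1\<^sub>m d) (fcs_W d b V m) \<in> carrier_mat (d * b) (d ^ Suc m * b)"
      using kron_carrier[OF one_carrier_mat[of d] W] by (simp add: mult_ac)
    have V': "kron (1\<^sub>m (d ^ m)) V \<in> carrier_mat (d ^ m * b) (d ^ Suc m * b)" by (rule kron_one_V_carrier[OF V])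
    have "?F = kron (1\<^sub>m d) (kron (1\<^sub>m (d ^ m)) V)"
      using kron_assoc[OF one_carrier_mat one_carrier_mat V, of d "d ^ m"] by (simp add: kron_one_one)
    then have KF: "kron (1\<^sub>m d) (fcs_W d b V m) * ?F = kron (1\<^sub>m d) (fcs_W d b V (Suc m))"
      using kron_mult[OF one_carrier_mat W one_carrier_mat V', of d] by simp
    have FY: "?F * Y \<in> carrier_mat (d ^ Suc m * b) r" by (rule mult_carrier_mat[OF F Suc.prems])
    have "foldr (\<lambda>k M. kron (1\<^sub>m (d ^ k)) V * M) [1..<Suc (Suc m)] Y
        = foldr (\<lambda>k M. kron (1\<^sub>m (d ^ k)) V * M) [1..<Suc m] (?F * Y)" by simp
    also have "\<dots> = kron (1\<^sub>m d) (fcs_W d b V m) * (?F * Y)" by (rule Suc.IH[OF FY])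
    also have "\<dots> = kron (1\<^sub>m d) (fcs_W d b V (Suc m)) * Y"
      unfolding KF[symmetric] by (rule assoc_mult_mat[OF K F Suc.prems, symmetric])
    finally show ?case .
  qed
  have "kron (1\<^sub>m d) (fcs_W d b V m) \<in> carrier_mat (d * b) (d ^ Suc m * b)"
    using kron_carrier[OF one_carrier_mat[of d] fcs_W_carrier[OF V, of m]] by (simp add: mult_ac)
  then show ?thesis unfolding fcs_V_def fold[OF one_carrier_mat] by simp
qed

lemma mat_trace_coisometry:
  assumes P: "P \<in> carrier_mat p q" and iso: "P * mat_adjoint P = 1\<^sub>m p" and X: "X \<in> carrier_mat p p"
  shows "mat_trace (mat_adjoint P * X * P) = mat_trace X"
proof -
  have P': "mat_adjoint P \<in> carrier_mat q p" using P by simp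
  have "mat_trace (mat_adjoint P * X * P) = mat_trace (P * (mat_adjoint P * X))"
    by (rule mat_trace_mult_commute[OF mult_carrier_mat[OF P' X] P])
  also have "P * (mat_adjoint P * X) = X"
    using iso X assoc_mult_mat[OF P P' X] by simp
  finally show ?thesis .
qed

lemma psd_adjoint_congruence:
  assumes "psd n A" "K \<in> carrier_mat n m"
  shows "psd m (mat_adjoint K * A * K)"
  using psd_congruence[OF assms(1) mat_adjoint_carrier[OF assms(2)]]
  by (simp add: mat_adjoint_mat_adjoint[OF assms(2)])

context pure_fcs
begin

abbreviation "W \<equiv> fcs_W d b V"

abbreviation "word m \<equiv> kron (1\<^sub>m d) (W m)"

abbreviation "\<rho>AB \<equiv> fcs_rho_AB V \<rho>"

lemma W_carrier: "W m \<in> carrier_mat b (d ^ m * b)"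
  by (rule fcs_W_carrier[OF V_carrier])

lemma word_carrier: "word m \<in> carrier_mat (d * b) (d ^ Suc m * b)"
  using kron_carrier[OF one_carrier_mat[of d] W_carrier[of m]] by (simp add: mult_ac)

lemma mat_adjoint_word: "mat_adjoint (word m) = kron (1\<^sub>m d) (mat_adjoint (W m))"
  by (simp add: mat_adjoint_kron[OF one_carrier_mat W_carrier] mat_adjoint_one)

lemma word_coisometry: "word m * mat_adjoint (word m) = 1\<^sub>m (d * b)"
  using kron_mult[OF one_carrier_mat[of d] W_carrier[of m] one_carrier_mat mat_adjoint_carrier[OF W_carrier[of m]]]
  by (simp add: mat_adjoint_word fcs_W_coisometry kron_one_one)

lemma density_rho_AB: "density_matrix (d * b) \<rho>AB"
  using density psd_adjoint_congruence[OF _ V_carrier, of \<rho>]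
    mat_trace_coisometry[OF V_carrier V_coisometry rho_carrier]
  by (simp add: density_matrix_iff fcs_rho_AB_def)

lemma rho_AB_carrier: "\<rho>AB \<in> carrier_mat (d * b) (d * b)"
  using density_rho_AB by (simp add: density_matrix_def)

lemma fcs_rho_chain_Suc:
  "fcs_rho_chain d b V \<rho> (Suc m) = ptrace2 (d ^ Suc m) b (mat_adjoint (word m) * \<rho>AB * word m)"
  by (simp add: fcs_rho_chain_def fcs_V_Suc[OF V_carrier])

lemma density_rho_chain: "density_matrix (d ^ Suc m) (fcs_rho_chain d b V \<rho> (Suc m))"
proof -
  have "psd (d ^ Suc m * b) (mat_adjoint (word m) * \<rho>AB * word m)"
    using density_rho_AB by (intro psd_adjoint_congruence[OF _ word_carrier]) (simp add: density_matrix_iff)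
  moreover from psd_carrier[OF this]
  have "mat_trace (fcs_rho_chain d b V \<rho> (Suc m)) = 1"
    unfolding fcs_rho_chain_Suc
    using mat_trace_coisometry[OF word_carrier word_coisometry rho_AB_carrier, of m] density_rho_AB
    by (simp add: mat_trace_ptrace2 density_matrix_iff del: power_Suc)
  ultimately show ?thesis
    by (simp add: density_matrix_iff fcs_rho_chain_Suc psd_ptrace2 del: power_Suc)
qed

lemma separable_rho_chain:
  assumes "separable d b \<rho>AB"
  shows "separable d (d ^ m) (fcs_rho_chain d b V \<rho> (Suc m))"
proof (rule separable_cone_imp_separable)
  have "separable_cone d (d ^ m * b)
      (kron (1\<^sub>m d) (mat_adjoint (W m)) * \<rho>AB * mat_adjoint (kron (1\<^sub>m d) (mat_adjoint (W m))))"
    by (rule separable_cone_congruence[OF separable_imp_separable_cone[OF assms] mat_adjoint_carrier[OF W_carrier]])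
  then have "separable_cone d (d ^ m * b) (mat_adjoint (word m) * \<rho>AB * word m)"
    unfolding mat_adjoint_word[symmetric] mat_adjoint_mat_adjoint[OF word_carrier] .
  from separable_cone_ptrace2[OF this]
  show "separable_cone d (d ^ m) (fcs_rho_chain d b V \<rho> (Suc m))" by (simp add: fcs_rho_chain_Suc)
  show "mat_trace (fcs_rho_chain d b V \<rho> (Suc m)) = 1"
    using density_rho_chain[of m] by (simp add: density_matrix_iff)
qed

section \<open>The recovery map and its limit\<close>

definition rho_inv :: "complex mat" where
  "rho_inv = (SOME R. R \<in> carrier_mat b b \<and> \<rho> * R = 1\<^sub>m b)"

lemma rho_inv: "rho_inv \<in> carrier_mat b b" "\<rho> * rho_inv = 1\<^sub>m b"
proof -
  obtain R where R: "inverts_mat \<rho> R" "inverts_mat R \<rho>"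
    using nonsingular by (auto simp: invertible_mat_def)
  then have 1: "\<rho> * R = 1\<^sub>m b" "R * \<rho> = 1\<^sub>m (dim_row R)" using rho_carrier by (auto simp: inverts_mat_def)
  have "dim_col R = b" using arg_cong[OF 1(1), of dim_col] by simp
  moreover have "dim_row R = b" using arg_cong[OF 1(2), of dim_col] rho_carrier by simp
  ultimately have "R \<in> carrier_mat b b \<and> \<rho> * R = 1\<^sub>m b" using 1 by blast
  then show "rho_inv \<in> carrier_mat b b" "\<rho> * rho_inv = 1\<^sub>m b"
    unfolding rho_inv_def by (metis (mono_tags, lifting) someI_ex)+
qed

text \<open>For a right inverse R of \<open>\<rho>\<close>, the congruence of \<open>\<rho>\<close>
  by R collapses to the adjoint of R, which is therefore positive; positivity includes hermiticity,
  so R is this adjoint.\<close>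

lemma psd_rho_inv: "psd b rho_inv"
proof -
  have p: "psd b \<rho>" using density by (simp add: density_matrix_iff)
  have "psd b (mat_adjoint rho_inv * \<rho> * rho_inv)" by (rule psd_adjoint_congruence[OF p rho_inv(1)])
  also have "mat_adjoint rho_inv * \<rho> * rho_inv = mat_adjoint rho_inv"
    using assoc_mult_mat[OF mat_adjoint_carrier[OF rho_inv(1)] rho_carrier rho_inv(1)] rho_inv(2)
      mat_adjoint_carrier[OF rho_inv(1)] by simp
  finally have "psd b (mat_adjoint rho_inv)" .
  from psd_mat_adjoint[OF this] this show ?thesis
    by (simp add: mat_adjoint_mat_adjoint[OF rho_inv(1)])
qed

definition recovery :: "nat \<Rightarrow> complex mat" where
  "recovery m = word m * kron (fcs_rho_chain d b V \<rho> (Suc m)) rho_inv * mat_adjoint (word m)"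

lemma separable_cone_recovery:
  assumes "separable d (d ^ m) (fcs_rho_chain d b V \<rho> (Suc m))"
  shows "separable_cone d b (recovery m)"
  unfolding recovery_def
  by (rule separable_cone_congruence[OF separable_cone_kron[OF separable_imp_separable_cone[OF assms] psd_rho_inv] W_carrier])

text \<open>By the mixing of the transfer operator each \<open>G m k j\<close> tends to
  \<open>\<rho> $$ (j, k)\<close> times the identity. The limit therefore acts trivially on
  \<open>\<rho>AB\<close> from both sides, and the memory sums leave the scalar
  \<open>Tr(\<rho> rho_inv \<rho>) = Tr \<rho> = 1\<close>.\<close>

lemma recovery_tendsto:
  assumes xy: "x < d * b" "y < d * b"
  shows "(\<lambda>m. recovery m $$ (x, y)) \<longlonglongrightarrow> \<rho>AB $$ (x, y)"
proof -
  define G where "G m k j x z = (\<Sum>s<d ^ Suc m. word m $$ (x, s * b + k) * cnj (word m $$ (z, s * b + j)))"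
    for m k j x z
  have G: "(\<lambda>m. G m k j x z) \<longlonglongrightarrow> \<rho> $$ (j, k) * (if x = z then 1 else 0)"
    if kj: "k < b" "j < b" and xz: "x < d * b" "z < d * b" for k j x z
  proof -
    \<comment> \<open>The matrix unit that selects the coefficient \<open>G\<close>; its mean is the
      transposed entry \<open>\<rho> $$ (j, k)\<close>.\<close>
    define E where "E = mat b b (\<lambda>(u, v). if u = k \<and> v = j then 1 else 0 :: complex)"
    have E: "E \<in> carrier_mat b b" by (simp add: E_def)
    have pick: "(\<Sum>u<b. \<Sum>v<b. h u v * E $$ (u, v)) = h k j" for h
    proof -
      have "(\<Sum>u<b. \<Sum>v<b. h u v * E $$ (u, v)) = (\<Sum>v<b. h k v * E $$ (k, v))"
        using kj by (intro sum_eq_single) (auto simp: E_def)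
      also have "\<dots> = h k j * E $$ (k, j)" using kj by (intro sum_eq_single) (auto simp: E_def)
      finally show ?thesis using kj by (simp add: E_def)
    qed
    have mean: "mean E = \<rho> $$ (j, k)" unfolding mean_eq_sum[OF E] by (rule pick)
    obtain a i where ai: "a < d" "i < b" "x = a * b + i" using xz(1) by (rule pair_index_cases)
    obtain c l where cl: "c < d" "l < b" "z = c * b + l" using xz(2) by (rule pair_index_cases)
    have "G m k j x z = (if a = c then (fcs_Ehat d V ^^ m) E $$ (i, l) else 0)" for m
    proof -
      have WE: "W m * kron (1\<^sub>m (d ^ m)) E \<in> carrier_mat b (d ^ m * b)"
        by (rule mult_carrier_mat[OF W_carrier]) (use E in simp)
      have Em: "kron (1\<^sub>m (d ^ m)) E \<in> carrier_mat (d ^ m * b) (d ^ m * b)" using E by simp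
      have "G m k j x z = (word m * kron (1\<^sub>m (d ^ Suc m)) E * mat_adjoint (word m)) $$ (x, z)"
        unfolding kron_one_conjugation_entry[OF word_carrier E xz] G_def
        by (rule pick[symmetric])
      also have "kron (1\<^sub>m (d ^ Suc m)) E = kron (1\<^sub>m d) (kron (1\<^sub>m (d ^ m)) E)"
        using kron_assoc[OF one_carrier_mat one_carrier_mat E, of d "d ^ m"] by (simp add: kron_one_one)
      also have "word m * kron (1\<^sub>m d) (kron (1\<^sub>m (d ^ m)) E) * mat_adjoint (word m)
          = kron (1\<^sub>m d) ((fcs_Ehat d V ^^ m) E)"
        unfolding mat_adjoint_word fcs_W_conjugation[OF V_carrier E, symmetric]
        by (simp add: kron_mult[OF one_carrier_mat W_carrier one_carrier_mat Em]
            kron_mult[OF one_carrier_mat WE one_carrier_mat mat_adjoint_carrier[OF W_carrier]])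
      also have "\<dots> $$ (x, z) = (if a = c then (fcs_Ehat d V ^^ m) E $$ (i, l) else 0)"
        unfolding ai cl
        by (rule kron_one_left_entry[OF fcs_Ehat_power_carrier[OF V_carrier E] ai(1,2) cl(1,2)])
      finally show ?thesis .
    qed
    moreover have "(\<lambda>m. if a = c then (fcs_Ehat d V ^^ m) E $$ (i, l) else 0)
        \<longlonglongrightarrow> (if a = c then mean E * 1\<^sub>m b $$ (i, l) else 0)"
      using fcs_Ehat_power_tendsto[OF E ai(2) cl(2)] by (cases "a = c") auto
    moreover have "x = z \<longleftrightarrow> a = c \<and> i = l"
    proof
      assume "x = z"
      then have "(a * b + i) div b = (c * b + l) div b" "(a * b + i) mod b = (c * b + l) mod b"
        unfolding ai cl by simp_all
      then show "a = c \<and> i = l" using ai cl by simp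
    qed (simp add: ai cl)
    ultimately show ?thesis using ai(2) cl(2) by (auto simp: mean split: if_splits)
  qed
  have "(\<lambda>m. \<Sum>k<b. \<Sum>l<b. \<Sum>j<b. \<Sum>z<d * b. \<Sum>z'<d * b.
      rho_inv $$ (k, l) * G m k j x z * \<rho>AB $$ (z, z') * G m j l z' y)
    \<longlonglongrightarrow> (\<Sum>k<b. \<Sum>l<b. \<Sum>j<b. \<Sum>z<d * b. \<Sum>z'<d * b.
      rho_inv $$ (k, l) * (\<rho> $$ (j, k) * (if x = z then 1 else 0)) * \<rho>AB $$ (z, z')
        * (\<rho> $$ (l, j) * (if z' = y then 1 else 0)))"
    by (intro tendsto_sum tendsto_mult tendsto_const G xy) auto
  also have "(\<Sum>k<b. \<Sum>l<b. \<Sum>j<b. \<Sum>z<d * b. \<Sum>z'<d * b.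
      rho_inv $$ (k, l) * (\<rho> $$ (j, k) * (if x = z then 1 else 0)) * \<rho>AB $$ (z, z')
        * (\<rho> $$ (l, j) * (if z' = y then 1 else 0)))
    = (\<Sum>k<b. \<Sum>l<b. \<Sum>j<b. \<rho> $$ (j, k) * rho_inv $$ (k, l) * (\<rho> $$ (l, j) * \<rho>AB $$ (x, y)))"
  proof (intro sum.cong refl)
    fix k l j
    have "(\<Sum>z<d * b. \<Sum>z'<d * b. rho_inv $$ (k, l) * (\<rho> $$ (j, k) * (if x = z then 1 else 0)) * \<rho>AB $$ (z, z')
        * (\<rho> $$ (l, j) * (if z' = y then 1 else 0)))
      = (\<Sum>z'<d * b. rho_inv $$ (k, l) * (\<rho> $$ (j, k) * (if x = x then 1 else 0)) * \<rho>AB $$ (x, z')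
        * (\<rho> $$ (l, j) * (if z' = y then 1 else 0)))"
      using xy by (intro sum_eq_single) auto
    also have "\<dots> = rho_inv $$ (k, l) * (\<rho> $$ (j, k) * (if x = x then 1 else 0)) * \<rho>AB $$ (x, y)
        * (\<rho> $$ (l, j) * (if y = y then 1 else 0))"
      using xy by (intro sum_eq_single) auto
    finally show "(\<Sum>z<d * b. \<Sum>z'<d * b. rho_inv $$ (k, l) * (\<rho> $$ (j, k) * (if x = z then 1 else 0)) * \<rho>AB $$ (z, z')
        * (\<rho> $$ (l, j) * (if z' = y then 1 else 0)))
      = \<rho> $$ (j, k) * rho_inv $$ (k, l) * (\<rho> $$ (l, j) * \<rho>AB $$ (x, y))"
      by simp
  qed
  \<comment> \<open>Summing over \<open>k\<close> first forms the entries of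
    \<open>\<rho> * rho_inv\<close>, the identity; the diagonal sum that remains is the trace of
    \<open>\<rho>\<close>.\<close>
  also have "\<dots> = (\<Sum>l<b. \<Sum>j<b. \<Sum>k<b. \<rho> $$ (j, k) * rho_inv $$ (k, l) * (\<rho> $$ (l, j) * \<rho>AB $$ (x, y)))"
    by (rule sum_swap3[symmetric])
  also have "\<dots> = (\<Sum>l<b. \<Sum>j<b. 1\<^sub>m b $$ (j, l) * (\<rho> $$ (l, j) * \<rho>AB $$ (x, y)))"
  proof (intro sum.cong refl)
    fix l j assume "l \<in> {..<b}" "j \<in> {..<b}"
    then have "(\<Sum>k<b. \<rho> $$ (j, k) * rho_inv $$ (k, l)) = 1\<^sub>m b $$ (j, l)"
      using mult_mat_entry[OF rho_carrier rho_inv(1), of j l] by (simp only: lessThan_iff rho_inv(2))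
    then show "(\<Sum>k<b. \<rho> $$ (j, k) * rho_inv $$ (k, l) * (\<rho> $$ (l, j) * \<rho>AB $$ (x, y)))
        = 1\<^sub>m b $$ (j, l) * (\<rho> $$ (l, j) * \<rho>AB $$ (x, y))"
      by (simp only: sum_distrib_right[symmetric])
  qed
  also have "\<dots> = (\<Sum>l<b. 1\<^sub>m b $$ (l, l) * (\<rho> $$ (l, l) * \<rho>AB $$ (x, y)))"
    by (intro sum.cong refl sum_eq_single) auto
  also have "\<dots> = mat_trace \<rho> * \<rho>AB $$ (x, y)"
    using rho_carrier by (simp add: mat_trace_def sum_distrib_right)
  also have "\<dots> = \<rho>AB $$ (x, y)" using density by (simp add: density_matrix_def)
  finally have lim: "(\<lambda>m. \<Sum>k<b. \<Sum>l<b. \<Sum>j<b. \<Sum>z<d * b. \<Sum>z'<d * b.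
      rho_inv $$ (k, l) * G m k j x z * \<rho>AB $$ (z, z') * G m j l z' y) \<longlonglongrightarrow> \<rho>AB $$ (x, y)" .
  have "recovery m $$ (x, y) = (\<Sum>k<b. \<Sum>l<b. \<Sum>j<b. \<Sum>z<d * b. \<Sum>z'<d * b.
      rho_inv $$ (k, l) * G m k j x z * \<rho>AB $$ (z, z') * G m j l z' y)" for m
    unfolding recovery_def fcs_rho_chain_Suc
    by (rule recovery_entry[OF word_carrier rho_AB_carrier rho_inv(1) xy]) (simp only: G_def)
  then show ?thesis using lim by simp
qed

lemma separable_rho_AB:
  assumes sep: "\<And>t. \<exists>m\<ge>t. separable d (d ^ m) (fcs_rho_chain d b V \<rho> (Suc m))"
  shows "separable d b \<rho>AB"
proof -
  \<comment> \<open>\<open>f\<close> need not be increasing: \<open>f t \<ge> t\<close> already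
    makes it diverge, which is enough to compose with the limit.\<close>
  obtain f where f: "\<And>t. f t \<ge> t" "\<And>t. separable d (d ^ f t) (fcs_rho_chain d b V \<rho> (Suc (f t)))"
    using sep by metis
  have f_top: "filterlim f at_top sequentially"
    unfolding filterlim_at_top using f(1) by (auto simp: eventually_sequentially intro: order_trans)
  have lim: "(\<lambda>t. recovery (f t) $$ (x, y)) \<longlonglongrightarrow> \<rho>AB $$ (x, y)" if "x < d * b" "y < d * b" for x y
    using filterlim_compose[OF recovery_tendsto[OF that] f_top] .
  have cone: "separable_cone d b (recovery (f t))" for t by (rule separable_cone_recovery[OF f(2)])
  have carrier: "recovery m \<in> carrier_mat (d * b) (d * b)" for m
    unfolding recovery_def using word_carrier[of m] carrier_matD[OF mat_adjoint_carrier[OF word_carrier[of m]]] by auto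
  define \<theta> where "\<theta> t = mat_trace (recovery (f t))" for t
  have "(\<lambda>t. \<Sum>i<d * b. recovery (f t) $$ (i, i)) \<longlonglongrightarrow> (\<Sum>i<d * b. \<rho>AB $$ (i, i))"
    by (intro tendsto_sum lim) auto
  moreover have "(\<Sum>i<d * b. \<rho>AB $$ (i, i)) = 1"
    using density_rho_AB by (auto simp: density_matrix_def mat_trace_def)
  moreover have "\<theta> = (\<lambda>t. \<Sum>i<d * b. recovery (f t) $$ (i, i))"
    by (simp add: fun_eq_iff \<theta>_def mat_trace_def carrier_matD[OF carrier])
  ultimately have \<theta>: "\<theta> \<longlonglongrightarrow> 1" by simp
  have "eventually (\<lambda>t. \<theta> t \<noteq> 0) sequentially" by (rule tendsto_imp_eventually_ne[OF \<theta>]) simp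
  \<comment> \<open>\<open>separable_closed\<close> asks for separability of every member of the
    sequence, so the sequence starts at \<open>T\<close>, from where the trace can be divided
    out.\<close>
  then obtain T where T: "\<And>t. t \<ge> T \<Longrightarrow> \<theta> t \<noteq> 0" by (auto simp: eventually_sequentially)
  define A where "A t = inverse (\<theta> (t + T)) \<cdot>\<^sub>m recovery (f (t + T))" for t
  show ?thesis
  proof (rule separable_closed)
    fix t
    have "0 \<le> \<theta> (t + T)" unfolding \<theta>_def by (rule separable_cone_trace_nonneg[OF cone])
    then have "0 \<le> inverse (\<theta> (t + T))" by (auto simp: less_eq_complex_def)
    then have "separable_cone d b (A t)" unfolding A_def by (rule separable_cone_smult[OF cone])
    moreover have "mat_trace (A t) = 1"
      using T[of "t + T"] by (simp add: A_def mat_trace_smult[OF carrier] \<theta>_def)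
    ultimately show "separable d b (A t)" by (rule separable_cone_imp_separable)
  next
    show "\<rho>AB \<in> carrier_mat (d * b) (d * b)" by (rule rho_AB_carrier)
  next
    fix i j assume ij: "i < d * b" "j < d * b"
    have "(\<lambda>t. inverse (\<theta> (t + T)) * recovery (f (t + T)) $$ (i, j)) \<longlonglongrightarrow> inverse 1 * \<rho>AB $$ (i, j)"
      by (intro tendsto_mult tendsto_inverse LIMSEQ_ignore_initial_segment[OF \<theta>]
          LIMSEQ_ignore_initial_segment[OF lim[OF ij]]) simp
    then show "(\<lambda>t. A t $$ (i, j)) \<longlonglongrightarrow> \<rho>AB $$ (i, j)"
      using ij by (simp add: A_def carrier_matD[OF carrier])
  qed
qed

end

theorem mainTheorem3:
  fixes d b :: nat and V \<rho> :: "complex mat"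
  assumes "pure_fcs d b V \<rho>"
  shows "(\<exists>n\<^sub>0\<ge>2. \<forall>n\<ge>n\<^sub>0. entangled d (d ^ (n - 1)) (fcs_rho_chain d b V \<rho> n))
     \<longleftrightarrow> entangled d b (fcs_rho_AB V \<rho>)"
proof
  interpret pure_fcs d b V \<rho> by (rule assms)
  show "entangled d b (fcs_rho_AB V \<rho>)"
    if chain: "\<exists>n\<^sub>0\<ge>2. \<forall>n\<ge>n\<^sub>0. entangled d (d ^ (n - 1)) (fcs_rho_chain d b V \<rho> n)"
  proof -
    \<comment> \<open>A single entangled chain suffices here, since separability of
      \<open>\<rho>AB\<close> would pass to chains of every length.\<close>
    obtain n where "entangled d (d ^ n) (fcs_rho_chain d b V \<rho> (Suc n))"
      using chain by (metis diff_Suc_1 le_SucI order_refl)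
    then show ?thesis using separable_rho_chain[of n] density_rho_AB by (auto simp: entangled_def)
  qed
  show "\<exists>n\<^sub>0\<ge>2. \<forall>n\<ge>n\<^sub>0. entangled d (d ^ (n - 1)) (fcs_rho_chain d b V \<rho> n)"
    if ent: "entangled d b (fcs_rho_AB V \<rho>)"
  proof (rule ccontr)
    assume neg: "\<not> ?thesis"
    have "\<exists>m\<ge>t. separable d (d ^ m) (fcs_rho_chain d b V \<rho> (Suc m))" for t
    proof -
      \<comment> \<open>The negated claim is used with \<open>t + 2\<close> as threshold, which
        respects the bound 2 and leaves \<open>m = n - 1\<close> above \<open>t\<close>. As the
        chain matrix is a density matrix, failure of entanglement means separability.\<close>
      obtain n where n: "n \<ge> t + 2" "\<not> entangled d (d ^ (n - 1)) (fcs_rho_chain d b V \<rho> n)"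
        using neg by (metis le_add2)
      then obtain m where m: "n = Suc m" by (cases n) auto
      show ?thesis
        using n density_rho_chain[of m] unfolding m by (intro exI[of _ m]) (auto simp: entangled_def)
    qed
    then have "separable d b (fcs_rho_AB V \<rho>)" by (rule separable_rho_AB)
    then show False using ent by (simp add: entangled_def)
  qed
qed

end
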